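(* Let $a$ be a nonzero element of $\mathcal A_{kl}$, with $k\neq l$ and $\rho_k\le\rho_l$. Then $$\varphi(aa^* )\,\Phi_r(a,a^* )\ \ge\ \rho_k^2+\rho_l^2,$$ with equality if and only if there exists a positive number $c$ such that the moments of $c\,aa^*$ in $(\mathcal A_{kk},\varphi_k)$ are the moments of the Marchenko–Pastur distribution with parameter $\frac{\rho_l}{\rho_k}$.
   Context: $(\mathcal A,\varphi)$ is a $W^*$-probability space with $\varphi$ a faithful tracial state, with nonzero self-adjoint pairwise orthogonal projections $p_1,\dots,p_d$ with sum $1$; $\rho_i=\varphi(p_i)$; $\mathcal D=\mathrm{Span}\{p_1,\dots,p_d\}$; $\mathcal A_{ij}=p_i\mathcal Ap_j$; $\varphi_i=\rho_i^{-1}\varphi|_{\mathcal A_{ii}}$. $L^2(\mathcal A)$ is the completion of $\mathcal A$ for $\|a\|_2=\varphi(aa^* )^{1/2}$, an $\mathcal A$-bimodule to which $*$ extends; $L^2(\mathcal A)_{ij}=p_iL^2(\mathcal A)p_j$, and $\varphi_i$ extends to $L^2(\mathcal A)_{ii}$. Simple elements of $L^2(\mathcal A)$ are the nonzero elements of $\bigcup_{i,j}L^2(\mathcal A)_{ij}$; for such $x\in L^2(\mathcal A)_{ij}$, put $r(x)=i$, $c(x)=j$. A finite sequence $(x_1,\dots,x_m)$ of simple elements is a square sequence if $c(x_i)=r(x_{i+1})$ for all $i$, with $x_{m+1}:=x_1$. Let $(a_i)_{i\in I}$ be a self-adjoint family of simple elements of $\mathcal A$ (i.e. there is an involution $*$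 of $I$ with $a_i^*=a_{*(i)}$). A family $(\xi_i)_{i\in I}$ of simple elements of $L^2(\mathcal A)$ fulfills conjugate relations for $(a_i)_{i\in I}$ if for all $i$, $r(\xi_i)=c(a_i)$, $c(\xi_i)=r(a_i)$, and for all $n\ge0$ and $i,i_1,\dots,i_n\in I$ such that $(\xi_i,a_{i_1},\dots,a_{i_n})$ is a square sequence, $$\varphi_{r(\xi_i)}(\xi_ia_{i_1}\cdots a_{i_n})=\sum_{m=1}^n\delta_{i,i_m}\,\varphi_{c(\xi_i)}(a_{i_1}\cdots a_{i_{m-1}})\,\varphi_{r(\xi_i)}(a_{i_{m+1}}\cdots a_{i_n}),$$ where $\varphi_j$ of an empty product is $1$. It is a conjugate system if moreover every $\xi_i$ lies in the $\|\cdot\|_2$-closure of the algebra generated by $\{a_i:i\in I\}\cup\mathcal D$ (it is then unique). The Fisher information is $\Phi_r((a_i)_{i\in I})=\sum_{i\in I}\|\xi_i\|_2^2$ if $(\xi_i)$ is a conjugate system, and $\infty$ if there is no conjugate system. $\Phi_r(a,a^* )$ is the case of the two-element family $(a,a^* )$. The Marchenko–Pastur distribution with parameter $\lambda\ge1$ has density $\frac{\sqrt{4\lambda-(x-1-\lambda)^2}}{2\pi x}$ on $[(1-\sqrt\lambda)^2,(1+\sqrt\lambda)^2]$. *)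

theory Defs
  imports "HOL-Analysis.Analysis"
begin

section \<open>W*-algebras\<close>

class cstar_algebra = real_normed_algebra_1 + banach +
  fixes scaleC :: "complex \<Rightarrow> 'a \<Rightarrow> 'a" (infixr "*\<^sub>C" 75)
    and star :: "'a \<Rightarrow> 'a"
  assumes scaleC_of_real: "complex_of_real r *\<^sub>C x = r *\<^sub>R x"
    and scaleC_add_right: "c *\<^sub>C (x + y) = c *\<^sub>C x + c *\<^sub>C y"
    and scaleC_add_left: "(b + c) *\<^sub>C x = b *\<^sub>C x + c *\<^sub>C x"
    and scaleC_scaleC: "b *\<^sub>C (c *\<^sub>C x) = (b * c) *\<^sub>C x"
    and scaleC_mult_left: "(c *\<^sub>C x) * y = c *\<^sub>C (x * y)"
    and scaleC_mult_right: "x * (c *\<^sub>C y) = c *\<^sub>C (x * y)"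
    and norm_scaleC: "norm (c *\<^sub>C x) = cmod c * norm x"
    and star_add: "star (x + y) = star x + star y"
    and star_scaleC: "star (c *\<^sub>C x) = cnj c *\<^sub>C star x"
    and star_mult: "star (x * y) = star y * star x"
    and star_star: "star (star x) = x"
    and cstar_identity: "norm (star x * x) = (norm x)\<^sup>2"

definition cscale_blinfun ::
    "complex \<Rightarrow> ('a::cstar_algebra \<Rightarrow>\<^sub>L complex) \<Rightarrow> ('a \<Rightarrow>\<^sub>L complex)" where
  "cscale_blinfun c f = blinfun_mult_right c o\<^sub>L f"

text \<open>
  A predual of a C*-algebra, in the sense of Sakai: a norm closed complex subspace \<open>P\<close> of the
  dual space such that evaluation identifies the algebra isometrically with the space of all
  bounded linear functionals on \<open>P\<close>. The type of bounded linear maps is that of real linear maps,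
  whence the explicit condition of complex linearity.
\<close>

definition is_predual :: "('a::cstar_algebra \<Rightarrow>\<^sub>L complex) set \<Rightarrow> bool" where
  "is_predual P \<longleftrightarrow>
     (\<forall>f\<in>P. \<forall>c x. blinfun_apply f (c *\<^sub>C x) = c * blinfun_apply f x) \<and>
     0 \<in> P \<and> (\<forall>f\<in>P. \<forall>g\<in>P. f + g \<in> P) \<and> (\<forall>c. \<forall>f\<in>P. cscale_blinfun c f \<in> P) \<and> closed P \<and>
     (\<forall>x. norm x = (SUP f\<in>{f\<in>P. norm f \<le> 1}. cmod (blinfun_apply f x))) \<and>
     (\<forall>F :: ('a \<Rightarrow>\<^sub>L complex) \<Rightarrow> complex.
        (\<forall>f\<in>P. \<forall>g\<in>P. F (f + g) = F f + F g) \<longrightarrow>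
        (\<forall>c. \<forall>f\<in>P. F (cscale_blinfun c f) = c * F f) \<longrightarrow>
        (\<exists>B. \<forall>f\<in>P. cmod (F f) \<le> B * norm f) \<longrightarrow>
        (\<exists>x. \<forall>f\<in>P. F f = blinfun_apply f x))"

text \<open>
  A W*-algebra is a C*-algebra that has a predual. The elements of the (unique) predual are the
  normal functionals, so membership of \<open>\<phi>\<close> says that the state is normal; it also yields that
  \<open>\<phi>\<close> is complex linear.
\<close>

definition tracial_wstar_prob_space :: "('a::cstar_algebra \<Rightarrow> complex) \<Rightarrow> bool" where
  "tracial_wstar_prob_space \<phi> \<longleftrightarrow>
     (\<exists>P. is_predual P \<and> (\<exists>f\<in>P. \<phi> = blinfun_apply f)) \<and>
     \<phi> 1 = 1 \<and>
     (\<forall>x. \<phi> (star x * x) \<in> \<real>\<^sub>\<ge>\<^sub>0) \<and>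
     (\<forall>x. \<phi> (star x * x) = 0 \<longrightarrow> x = 0) \<and>
     (\<forall>x y. \<phi> (x * y) = \<phi> (y * x))"

definition projection_partition :: "nat \<Rightarrow> (nat \<Rightarrow> 'a::cstar_algebra) \<Rightarrow> bool" where
  "projection_partition d p \<longleftrightarrow>
     (\<forall>i\<in>{1..d}. p i \<noteq> 0 \<and> star (p i) = p i \<and> p i * p i = p i) \<and>
     (\<forall>i\<in>{1..d}. \<forall>j\<in>{1..d}. i \<noteq> j \<longrightarrow> p i * p j = 0) \<and>
     (\<Sum>i\<in>{1..d}. p i) = 1"

inductive_set generated_algebra :: "'a::cstar_algebra set \<Rightarrow> 'a set"
  for S :: "'a set" where
  gen_base: "x \<in> S \<Longrightarrow> x \<in> generated_algebra S"
| gen_add: "x \<in> generated_algebra S \<Longrightarrow> y \<in> generated_algebra S \<Longrightarrow> x + y \<in> generated_algebra S"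
| gen_scale: "x \<in> generated_algebra S \<Longrightarrow> c *\<^sub>C x \<in> generated_algebra S"
| gen_mult: "x \<in> generated_algebra S \<Longrightarrow> y \<in> generated_algebra S \<Longrightarrow> x * y \<in> generated_algebra S"

section \<open>The completion for the 2-norm\<close>

context
  fixes \<phi> :: "'a::cstar_algebra \<Rightarrow> complex"
begin

definition norm2 :: "'a \<Rightarrow> real" where
  "norm2 a = sqrt (Re (\<phi> (a * star a)))"

text \<open>
  Elements of the completion are classes of 2-norm Cauchy sequences modulo 2-norm null sequences.
\<close>

definition cauchy2 :: "(nat \<Rightarrow> 'a) set" where
  "cauchy2 = {x. \<forall>e>0. \<exists>N. \<forall>m\<ge>N. \<forall>n\<ge>N. norm2 (x m - x n) < e}"

definition null2_rel :: "((nat \<Rightarrow> 'a) \<times> (nat \<Rightarrow> 'a)) set" where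
  "null2_rel = {(x, y). x \<in> cauchy2 \<and> y \<in> cauchy2 \<and> (\<lambda>n. norm2 (x n - y n)) \<longlonglongrightarrow> 0}"

definition L2 :: "(nat \<Rightarrow> 'a) set set" where
  "L2 = cauchy2 // null2_rel"

definition L2_embed :: "'a \<Rightarrow> (nat \<Rightarrow> 'a) set" where
  "L2_embed a = null2_rel `` {\<lambda>n. a}"

definition L2_rep :: "(nat \<Rightarrow> 'a) set \<Rightarrow> nat \<Rightarrow> 'a" where
  "L2_rep \<xi> = (SOME x. x \<in> \<xi>)"

definition L2_diff :: "(nat \<Rightarrow> 'a) set \<Rightarrow> (nat \<Rightarrow> 'a) set \<Rightarrow> (nat \<Rightarrow> 'a) set" where
  "L2_diff \<xi> \<eta> = null2_rel `` {\<lambda>n. L2_rep \<xi> n - L2_rep \<eta> n}"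

text \<open>The bimodule structure, as the two-sided product of \<open>a\<close>, \<open>\<xi>\<close> and \<open>b\<close>.\<close>

definition L2_mult :: "'a \<Rightarrow> (nat \<Rightarrow> 'a) set \<Rightarrow> 'a \<Rightarrow> (nat \<Rightarrow> 'a) set" where
  "L2_mult a \<xi> b = null2_rel `` {\<lambda>n. a * L2_rep \<xi> n * b}"

definition L2_norm :: "(nat \<Rightarrow> 'a) set \<Rightarrow> real" where
  "L2_norm \<xi> = lim (\<lambda>n. norm2 (L2_rep \<xi> n))"

definition L2_state :: "(nat \<Rightarrow> 'a) set \<Rightarrow> complex" where
  "L2_state \<xi> = lim (\<lambda>n. \<phi> (L2_rep \<xi> n))"

definition L2_closure :: "'a set \<Rightarrow> (nat \<Rightarrow> 'a) set set" where
  "L2_closure S = {\<xi>\<in>L2. \<forall>e>0. \<exists>b\<in>S. L2_norm (L2_diff \<xi> (L2_embed b)) < e}"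

end

section \<open>Rectangular spaces and Fisher information\<close>

context
  fixes \<phi> :: "'a::cstar_algebra \<Rightarrow> complex" and d :: nat and p :: "nat \<Rightarrow> 'a"
begin

definition rho :: "nat \<Rightarrow> real" where
  "rho i = Re (\<phi> (p i))"

definition diag_span :: "'a set" where
  "diag_span = {x. \<exists>c. x = (\<Sum>i\<in>{1..d}. c i *\<^sub>C p i)}"

definition block :: "nat \<Rightarrow> nat \<Rightarrow> 'a set" where
  "block i j = {p i * x * p j |x. True}"

definition L2_block :: "nat \<Rightarrow> nat \<Rightarrow> (nat \<Rightarrow> 'a) set set" where
  "L2_block i j = {L2_mult \<phi> (p i) \<xi> (p j) |\<xi>. \<xi> \<in> L2 \<phi>}"

definition simple :: "(nat \<Rightarrow> 'a) set \<Rightarrow> bool" where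
  "simple \<xi> \<longleftrightarrow> \<xi> \<noteq> L2_embed \<phi> 0 \<and> (\<exists>i\<in>{1..d}. \<exists>j\<in>{1..d}. \<xi> \<in> L2_block i j)"

definition row :: "(nat \<Rightarrow> 'a) set \<Rightarrow> nat" where
  "row \<xi> = (THE i. i \<in> {1..d} \<and> (\<exists>j\<in>{1..d}. \<xi> \<in> L2_block i j))"

definition col :: "(nat \<Rightarrow> 'a) set \<Rightarrow> nat" where
  "col \<xi> = (THE j. j \<in> {1..d} \<and> (\<exists>i\<in>{1..d}. \<xi> \<in> L2_block i j))"

definition square_sequence :: "(nat \<Rightarrow> 'a) set list \<Rightarrow> bool" where
  "square_sequence xs \<longleftrightarrow>
     xs \<noteq> [] \<and> (\<forall>\<xi>\<in>set xs. simple \<xi>) \<and>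
     (\<forall>i<length xs. col (xs ! i) = row (xs ! (Suc i mod length xs)))"

text \<open>
  The states of the corner algebras, on \<open>block i i\<close> and on \<open>L2_block i i\<close>.
\<close>

definition corner_state :: "nat \<Rightarrow> 'a \<Rightarrow> complex" where
  "corner_state i x = \<phi> x / of_real (rho i)"

definition L2_corner_state :: "nat \<Rightarrow> (nat \<Rightarrow> 'a) set \<Rightarrow> complex" where
  "L2_corner_state i \<xi> = L2_state \<phi> \<xi> / of_real (rho i)"

text \<open>
  The empty word has state 1: in the corner algebra the empty product is \<open>p i\<close>, whereas
  \<open>prod_list []\<close> is the unit of the whole algebra.
\<close>

definition word_state :: "nat \<Rightarrow> 'a list \<Rightarrow> complex" where
  "word_state i w = (if w = [] then 1 else corner_state i (prod_list w))"

text \<open>Likewise the factor \<open>p i\<close> only matters for \<open>n = 0\<close>.\<close>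

definition corner_moment :: "nat \<Rightarrow> 'a \<Rightarrow> nat \<Rightarrow> complex" where
  "corner_moment i x n = corner_state i (p i * x ^ n)"

definition self_adjoint_family :: "'i set \<Rightarrow> ('i \<Rightarrow> 'a) \<Rightarrow> bool" where
  "self_adjoint_family I a \<longleftrightarrow>
     (\<forall>i\<in>I. simple (L2_embed \<phi> (a i))) \<and>
     (\<exists>s. (\<forall>i\<in>I. s i \<in> I \<and> s (s i) = i \<and> star (a i) = a (s i)))"

definition conjugate_relations ::
    "'i set \<Rightarrow> ('i \<Rightarrow> 'a) \<Rightarrow> ('i \<Rightarrow> (nat \<Rightarrow> 'a) set) \<Rightarrow> bool" where
  "conjugate_relations I a \<xi> \<longleftrightarrow>
     self_adjoint_family I a \<and>
     (\<forall>i\<in>I. simple (\<xi> i) \<and>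
        row (\<xi> i) = col (L2_embed \<phi> (a i)) \<and> col (\<xi> i) = row (L2_embed \<phi> (a i)) \<and>
        (\<forall>w. set w \<subseteq> I \<longrightarrow> square_sequence (\<xi> i # map (\<lambda>j. L2_embed \<phi> (a j)) w) \<longrightarrow>
           L2_corner_state (row (\<xi> i)) (L2_mult \<phi> 1 (\<xi> i) (prod_list (map a w))) =
           (\<Sum>m<length w. of_bool (i = w ! m) *
              word_state (col (\<xi> i)) (map a (take m w)) *
              word_state (row (\<xi> i)) (map a (drop (Suc m) w)))))"

definition conjugate_system ::
    "'i set \<Rightarrow> ('i \<Rightarrow> 'a) \<Rightarrow> ('i \<Rightarrow> (nat \<Rightarrow> 'a) set) \<Rightarrow> bool" where
  "conjugate_system I a \<xi> \<longleftrightarrow>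
     conjugate_relations I a \<xi> \<and>
     (\<forall>i\<in>I. \<xi> i \<in> L2_closure \<phi> (generated_algebra (a ` I \<union> diag_span)))"

text \<open>
  A conjugate system is unique on \<open>I\<close>, so the choice does not affect the value.
\<close>

definition fisher_information :: "'i set \<Rightarrow> ('i \<Rightarrow> 'a) \<Rightarrow> ennreal" where
  "fisher_information I a =
     (if \<exists>\<xi>. conjugate_system I a \<xi>
      then (\<Sum>\<^sub>\<infinity>i\<in>I. ennreal ((L2_norm \<phi> ((SOME \<xi>. conjugate_system I a \<xi>) i))\<^sup>2))
      else \<infinity>)"

text \<open>The Fisher information of the two-element family \<open>(a, b)\<close>.\<close>

definition fisher_information_pair :: "'a \<Rightarrow> 'a \<Rightarrow> ennreal" where
  "fisher_information_pair a b = fisher_information (UNIV :: bool set) (\<lambda>t. if t then a else b)"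

end

section \<open>The Marchenko--Pastur distribution\<close>

definition marchenko_pastur_density :: "real \<Rightarrow> real \<Rightarrow> real" where
  "marchenko_pastur_density t x =
     (if x \<in> {(1 - sqrt t)\<^sup>2 .. (1 + sqrt t)\<^sup>2}
      then sqrt (4 * t - (x - 1 - t)\<^sup>2) / (2 * pi * x) else 0)"

definition marchenko_pastur :: "real \<Rightarrow> real measure" where
  "marchenko_pastur t = density lborel (\<lambda>x. ennreal (marchenko_pastur_density t x))"

end

theory Submission
  imports Defs
begin

text \<open>
  The conjugate relation for the words \<open>a\<close> and \<open>a\<^sup>*\<close> says that the inner products of the conjugate
  variables with \<open>a\<^sup>*\<close> and \<open>a\<close> are \<open>\<rho>\<^sub>l\<close> and \<open>\<rho>\<^sub>k\<close>, so the inequality is Cauchy--Schwarz. Equality forces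
  the conjugate variables to be positive multiples of \<open>a\<^sup>*\<close> and \<open>a\<close>. For such multiples the
  conjugate relations are a quadratic recursion for the moments of \<open>c a a\<^sup>*\<close>, namely
  \<open>M (n + 1) = (\<Sum>j\<le>n. M j M (n - j)) + (\<lambda> - 1) M n\<close> with \<open>\<lambda> = \<rho>\<^sub>l / \<rho>\<^sub>k\<close>, whose solution with
  \<open>M 0 = 1\<close> is the moment sequence of the Marchenko--Pastur distribution. Conversely, if the moments
  satisfy this recursion, these multiples form a conjugate system.
\<close>

text \<open>The bound tests each conjugate variable against a single letter, where the right-hand
  side of the conjugate relation is 1; longer words matter only once equality holds. The term with
  \<lambda> - 1 is a defect of the trace at order zero: the moments of \<open>a * star a\<close>
  weighted by \<open>rk\<close> and those of \<open>star a * a\<close> weighted by \<open>rl\<close>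
  agree from order one on, but begin with \<open>rk\<close> and \<open>rl\<close>, and the
  convolution in the conjugate relation mixes both kinds. By the same symmetry, equality for the
  variable of \<open>a\<close> alone yields the whole recursion, with c = \<open>rl\<close> divided
  by the squared 2-norm of \<open>a\<close>. The Fisher information evaluates an arbitrarily chosen
  conjugate system. For the converse it is therefore not enough to exhibit one; uniqueness is
  needed, and there the closure condition enters. Elements of the completion are classes of Cauchy
  sequences, so all arguments are limits along representatives and rest on the boundedness of
  multiplication in the 2-norm. The substitution x = 1 + t - 2 sqrt t cos \<theta> turns
  multiplication by x into a walk on the sine functions. The total mass escapes the resulting
  recursion because of the factor 1/x in the density.\<close>

section \<open>Moments of the Marchenko--Pastur distribution\<close>

text \<open>
  Here \<open>e n j\<close> counts weighted walks of length \<open>n\<close> on the half line from site \<open>1\<close> to site \<open>j\<close>.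
  A walk to site \<open>j + 2\<close> is split at its last visit of site \<open>j + 1\<close>.
\<close>

lemma last_exit_recursion:
  fixes e :: "nat \<Rightarrow> nat \<Rightarrow> real"
  assumes e0: "\<And>j. e 0 j = of_bool (j = 1)" and en0: "\<And>n. e n 0 = 0"
    and step: "\<And>n j. e (Suc n) (Suc j) = m * e n (Suc j) + s * (e n (Suc (Suc j)) + e n j)"
  shows "e n (Suc (Suc j)) = s * (\<Sum>i<n. e i (Suc j) * e (n - Suc i) 1)"
proof (induction n arbitrary: j)
  case 0
  then show ?case by (simp add: e0)
next
  case (Suc n)
  have *: "(\<Sum>i<n. e (Suc i) (Suc j) * e (n - Suc i) 1) =
      m * (\<Sum>i<n. e i (Suc j) * e (n - Suc i) 1)
      + s * (\<Sum>i<n. e i (Suc (Suc j)) * e (n - Suc i) 1)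
      + s * (\<Sum>i<n. e i j * e (n - Suc i) 1)"
    by (simp add: step sum_distrib_left sum.distrib algebra_simps)
  \<comment> \<open>The induction hypothesis one site lower, in a form that covers
    \<open>j = 0\<close> too: there \<open>e i 0\<close> vanishes and the walk is already at its
    starting site.\<close>
  have **: "e n (Suc j) = e 0 (Suc j) * e n 1 + s * (\<Sum>i<n. e i j * e (n - Suc i) 1)"
  proof (cases j)
    case 0
    then show ?thesis by (simp add: e0 en0)
  next
    case (Suc j')
    then show ?thesis using Suc.IH[of j'] by (simp add: e0)
  qed
  have "(\<Sum>i<Suc n. e i (Suc j) * e (Suc n - Suc i) 1)
      = e 0 (Suc j) * e n 1 + (\<Sum>i<n. e (Suc i) (Suc j) * e (n - Suc i) 1)"
    by (subst sum.lessThan_Suc_shift) simp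
  also have "s * \<dots> = m * e n (Suc (Suc j)) + s * (e n (Suc (Suc (Suc j))) + e n (Suc j))"
    unfolding * ** Suc.IH[of "Suc j"] Suc.IH[of j] by (simp add: algebra_simps)
  finally show ?case by (simp add: step)
qed

text \<open>Orthogonality of the sines is what will make the walks start at site 1.\<close>

lemma integral_sin_mult_sin:
  "((\<lambda>x. sin (real j * x) * sin x) has_integral (if j = 1 then pi / 2 else 0)) {0..pi}"
proof (cases "j = 1")
  case True
  have sq: "1 / 2 - cos (2 * x) / 2 = sin x * sin x" for x :: real
    by (simp add: cos_double_sin power2_eq_square diff_divide_distrib)
  have "((\<lambda>x. 1 / 2 - cos (2 * x) / 2) has_integral
      ((pi / 2 - sin (2 * pi) / 4) - (0 / 2 - sin (2 * 0) / 4))) {0..pi}"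
    by (intro fundamental_theorem_of_calculus)
       (auto intro!: derivative_eq_intros simp flip: has_real_derivative_iff_has_vector_derivative
         )
  then show ?thesis using True unfolding sq by simp
next
  case False
  \<comment> \<open>\<open>q\<close> and \<open>q + 2\<close> are j - 1 and j + 1, the two
    frequencies in the product-to-sum formula; neither is zero when j differs from 1.\<close>
  define q where "q = real j - 1"
  have q: "q \<noteq> 0" "q + 2 \<noteq> 0" using False by (auto simp: q_def)
  have qpi: "sin (q * pi) = 0" "sin ((q + 2) * pi) = 0"
    using sin_integer_2pi[of "q/2"] by (auto simp: q_def sin_zero_iff_int2 algebra_simps
       intro: exI[of _ "int j - 1"] exI[of _ "int j + 1"])
  have "((\<lambda>x. sin (real j * x) * sin x) has_integral
      ((sin (q * pi) / (2 * q) - sin ((q + 2) * pi) / (2 * (q + 2)))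
        - (sin (q * 0) / (2 * q) - sin ((q + 2) * 0) / (2 * (q + 2))))) {0..pi}"
  proof (intro fundamental_theorem_of_calculus)
    fix x :: real
    have eq: "cos (q * x) * q / (2 * q) - cos ((q + 2) * x) * (q + 2) / (2 * (q + 2)) =
        sin (real j * x) * sin x"
    proof -
      have "q * x = real j * x - x" "(q + 2) * x = real j * x + x"
        by (auto simp: q_def algebra_simps)
      then have "cos (q * x) / 2 - cos ((q + 2) * x) / 2 = sin (real j * x) * sin x"
        by (simp add: cos_add cos_diff diff_divide_distrib add_divide_distrib)
      moreover have half: "A * z / (2 * z) = A / 2" if "z \<noteq> 0" for A z :: real
        using that by simp
      ultimately show ?thesis unfolding half[OF q(1)] half[OF q(2)] by simp
    qed
    have "((\<lambda>x. sin (q * x) / (2 * q) - sin ((q + 2) * x) / (2 * (q + 2)))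
        has_real_derivative (cos (q * x) * q / (2 * q) - cos ((q + 2) * x) * (q + 2) / (2 * (q + 2))))
        (at x within {0..pi})"
      using q by (auto intro!: derivative_eq_intros)
    then show "((\<lambda>x. sin (q * x) / (2 * q) - sin ((q + 2) * x) / (2 * (q + 2)))
        has_vector_derivative (sin (real j * x) * sin x)) (at x within {0..pi})"
      unfolding eq by (simp add: has_real_derivative_iff_has_vector_derivative)
  qed simp
  then show ?thesis using False by (simp add: qpi)
qed

text \<open>The step rule of the walk: multiplication by \<open>2 * cos x\<close> moves a sine to
  its two neighbours.\<close>

lemma two_cos_mult_sin: "2 * cos x * sin (real (Suc j) * x) = sin (real (Suc (Suc j)) * x) + sin (real j * x)"
proof -
  have "real (Suc (Suc j)) * x = real (Suc j) * x + x" "real j * x = real (Suc j) * x - x"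
    by (auto simp: algebra_simps)
  then show ?thesis by (simp add: sin_add sin_diff)
qed

section \<open>Trigonometric form of the Marchenko-Pastur integrals\<close>

text \<open>\<open>g\<close> maps \<open>{0..pi}\<close> increasingly onto the support. Both the
  square root in the density and the derivative of \<open>g\<close> become
  \<open>2 * sqrt t * sin \<theta>\<close>, whence the squared sine.\<close>

lemma marchenko_pastur_moment_trig:
  fixes t :: real
  assumes "t \<ge> 1"
  defines "g \<equiv> \<lambda>\<theta>. 1 + t - 2 * sqrt t * cos \<theta>"
  shows "(LINT x|marchenko_pastur t. x ^ n) =
    (LINT \<theta>|lborel. g \<theta> ^ n * (2 * t * (sin \<theta>)\<^sup>2 / (pi * g \<theta>)) * indicator {0..pi} \<theta>)"
    (is "_ = integral\<^sup>L lborel ?h")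
proof -
  let ?f = "marchenko_pastur_density t"
  have m: "?f \<in> borel_measurable borel"
    unfolding marchenko_pastur_density_def by measurable
  have dens: "?f x \<ge> 0" for x
  proof (cases "x \<in> {(1 - sqrt t)\<^sup>2 .. (1 + sqrt t)\<^sup>2}")
    case True
    then have "x \<ge> 0" by (meson atLeastAtMost_iff order_trans zero_le_power2)
    have "\<bar>x - 1 - t\<bar> \<le> 2 * sqrt t"
      using True assms(1) by (auto simp: power2_eq_square algebra_simps abs_le_iff)
    then have "(x - 1 - t)\<^sup>2 \<le> (2 * sqrt t)\<^sup>2"
      unfolding abs_le_square_iff[symmetric] by simp
    then have "sqrt (4 * t - (x - 1 - t)\<^sup>2) \<ge> 0"
      using assms(1) by (simp add: power_mult_distrib)
    then show ?thesis using \<open>x \<ge> 0\<close> by (simp add: marchenko_pastur_density_def)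
  next
    case False
    then show ?thesis unfolding marchenko_pastur_density_def by (simp only: if_False order_refl)
  qed
  have gpos: "g \<theta> \<ge> 0" for \<theta>
  proof -
    have "(1 - sqrt t)\<^sup>2 + 2 * sqrt t * (1 - cos \<theta>) \<ge> 0"
      using assms(1) by (intro add_nonneg_nonneg mult_nonneg_nonneg) auto
    then show ?thesis using assms(1) by (simp add: g_def power2_eq_square algebra_simps)
  qed
  \<comment> \<open>For negative x the power may be negative, but x then lies to the left of the
    support.\<close>
  have pos: "x ^ n * ?f x \<ge> 0" for x
  proof (cases "x \<ge> 0")
    case False
    have "x < (1 - sqrt t)\<^sup>2"
      using False by (smt (verit) zero_le_power2)
    then show ?thesis by (simp add: marchenko_pastur_density_def)
  qed (simp add: dens)
  have dg: "?f (g \<theta>) * (2 * sqrt t * sin \<theta>) = 2 * t * (sin \<theta>)\<^sup>2 / (pi * g \<theta>)"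
    if "\<theta> \<in> {0..pi}" for \<theta>
  proof -
    have c: "1 - cos \<theta> \<ge> 0" "1 + cos \<theta> \<ge> 0"
      using cos_ge_minus_one[of \<theta>] cos_le_one[of \<theta>] by linarith+
    have "g \<theta> - (1 - sqrt t)\<^sup>2 = 2 * sqrt t * (1 - cos \<theta>)"
         "(1 + sqrt t)\<^sup>2 - g \<theta> = 2 * sqrt t * (1 + cos \<theta>)"
      using assms(1) by (auto simp: g_def power2_eq_square algebra_simps)
    moreover have "2 * sqrt t * (1 - cos \<theta>) \<ge> 0" "2 * sqrt t * (1 + cos \<theta>) \<ge> 0"
      using assms(1) c by simp_all
    ultimately have "g \<theta> \<in> {(1 - sqrt t)\<^sup>2 .. (1 + sqrt t)\<^sup>2}"
      by simp
    moreover have "4 * t - (g \<theta> - 1 - t)\<^sup>2 = (2 * sqrt t * sin \<theta>)\<^sup>2"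
      using assms(1) by (simp add: g_def power_mult_distrib sin_squared_eq algebra_simps)
    then have "sqrt (4 * t - (g \<theta> - 1 - t)\<^sup>2) = 2 * sqrt t * sin \<theta>"
      using assms(1) that by (simp add: sin_ge_zero)
    ultimately show ?thesis
      using assms(1) by (simp add: marchenko_pastur_density_def power2_eq_square algebra_simps)
  qed
  have "(LINT x|marchenko_pastur t. x ^ n) = (LINT x|lborel. x ^ n * ?f x)"
    unfolding marchenko_pastur_def using m dens
    by (subst integral_density) (auto simp: mult.commute)
  \<comment> \<open>The integrand is nonnegative, so the change of variables can be made for
    nonnegative integrals, where no integrability has to be shown first.\<close>
  also have "\<dots> = enn2real (\<integral>\<^sup>+ x. ennreal (x ^ n * ?f x) \<partial>lborel)"
    using m pos by (intro integral_eq_nn_integral) auto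
  also have "(\<integral>\<^sup>+ x. ennreal (x ^ n * ?f x) \<partial>lborel)
      = (\<integral>\<^sup>+ x. ennreal (x ^ n * ?f x * indicator {g 0..g pi} x) \<partial>lborel)"
    using assms(1) by (intro nn_integral_cong)
      (auto simp: g_def marchenko_pastur_density_def indicator_def power2_eq_square algebra_simps)
  also have "\<dots> = (\<integral>\<^sup>+ \<theta>. ennreal (g \<theta> ^ n * ?f (g \<theta>) * (2 * sqrt t * sin \<theta>) * indicator {0..pi} \<theta>) \<partial>lborel)"
  proof (intro nn_integral_substitution)
    show "set_borel_measurable borel {g 0..g pi} (\<lambda>x. x ^ n * ?f x)"
      using m unfolding set_borel_measurable_def by measurable
    show "(g has_real_derivative 2 * sqrt t * sin \<theta>) (at \<theta>)" for \<theta>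
      unfolding g_def by (auto intro!: derivative_eq_intros)
    show "continuous_on {0..pi} (\<lambda>\<theta>. 2 * sqrt t * sin \<theta>)"
      by (intro continuous_intros)
    show "2 * sqrt t * sin \<theta> \<ge> 0" if "\<theta> \<in> {0..pi}" for \<theta>
      using that assms(1) by (simp add: sin_ge_zero)
  qed simp
  also have "\<dots> = (\<integral>\<^sup>+ \<theta>. ennreal (?h \<theta>) \<partial>lborel)"
  proof (intro nn_integral_cong arg_cong[where f = ennreal])
    fix \<theta>
    show "g \<theta> ^ n * ?f (g \<theta>) * (2 * sqrt t * sin \<theta>) * indicator {0..pi} \<theta> = ?h \<theta>"
      unfolding mult.assoc[of "g \<theta> ^ n"] by (cases "\<theta> \<in> {0..pi}") (simp_all only: dg, simp)
  qed
  also have "enn2real \<dots> = integral\<^sup>L lborel ?h"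
    using gpos assms(1)
    by (intro integral_eq_nn_integral[symmetric])
       (auto simp: g_def intro!: AE_I2 mult_nonneg_nonneg divide_nonneg_nonneg zero_le_power)
  finally show ?thesis .
qed

section \<open>Recursion and total mass\<close>

context
  fixes t :: real
  assumes t: "t \<ge> 1"
begin

private definition g :: "real \<Rightarrow> real" where "g \<theta> = 1 + t - 2 * sqrt t * cos \<theta>"

private lemma cont_g: "continuous_on A g"
  unfolding g_def by (intro continuous_intros)

text \<open>In the basis of sines, multiplication by \<open>g\<close> is a tridiagonal matrix with
  diagonal \<open>1 + t\<close> and off-diagonal \<open>- sqrt t\<close>; for positive j this is the
  entry at 1 and j of its n-th power. The factor \<open>2 / pi\<close> normalises
  \<open>e 0 1\<close> to 1.\<close>

private definition e :: "nat \<Rightarrow> nat \<Rightarrow> real" where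
  "e n j = 2 / pi * integral {0..pi} (\<lambda>\<theta>. g \<theta> ^ n * (sin (real j * \<theta>) * sin \<theta>))"

private lemma e_0: "e 0 j = of_bool (j = 1)"
  using integral_sin_mult_sin[of j] by (auto simp: e_def dest!: integral_unique)

private lemma e_step:
  "e (Suc n) (Suc j) = (1 + t) * e n (Suc j) + (- sqrt t) * (e n (Suc (Suc j)) + e n j)"
proof -
  let ?I = "\<lambda>j \<theta>. g \<theta> ^ n * (sin (real j * \<theta>) * sin \<theta>)"
  have i: "?I j integrable_on {0..pi}" for j
    by (intro integrable_continuous_interval continuous_intros cont_g)
  have "g \<theta> ^ Suc n * (sin (real (Suc j) * \<theta>) * sin \<theta>) =
     (1 + t) * ?I (Suc j) \<theta> + (- sqrt t) * (?I (Suc (Suc j)) \<theta> + ?I j \<theta>)" for \<theta>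
  proof -
    have "g \<theta> ^ Suc n * (sin (real (Suc j) * \<theta>) * sin \<theta>) =
      (1 + t) * ?I (Suc j) \<theta>
        + (- sqrt t) * (g \<theta> ^ n * ((2 * cos \<theta> * sin (real (Suc j) * \<theta>)) * sin \<theta>))"
      by (simp add: g_def algebra_simps)
    then show ?thesis unfolding two_cos_mult_sin by (simp add: algebra_simps)
  qed
  then have "integral {0..pi} (\<lambda>\<theta>. g \<theta> ^ Suc n * (sin (real (Suc j) * \<theta>) * sin \<theta>)) =
     integral {0..pi} (\<lambda>\<theta>. (1 + t) * ?I (Suc j) \<theta> + (- sqrt t) * (?I (Suc (Suc j)) \<theta> + ?I j \<theta>))"
    by presburger
  also have "\<dots> = (1 + t) * integral {0..pi} (?I (Suc j))
      + (- sqrt t) * (integral {0..pi} (?I (Suc (Suc j))) + integral {0..pi} (?I j))"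
    by (intro integral_unique has_integral_add has_integral_mult_right integrable_integral i)
  finally have "e (Suc n) (Suc j) = 2 / pi * ((1 + t) * integral {0..pi} (?I (Suc j))
      + (- sqrt t) * (integral {0..pi} (?I (Suc (Suc j))) + integral {0..pi} (?I j)))"
    unfolding e_def by (rule arg_cong)
  then show ?thesis unfolding e_def by (simp only: distrib_left mult.left_commute)
qed

text \<open>The step to site 2 and the last exit formula each contribute a factor
  \<open>- sqrt t\<close>, so that only \<open>t\<close> remains.\<close>

private lemma e_1_recursion:
  "e (Suc n) 1 = (1 + t) * e n 1 + t * (\<Sum>i<n. e i 1 * e (n - Suc i) 1)"
proof -
  have "e n (Suc (Suc 0)) = (- sqrt t) * (\<Sum>i<n. e i (Suc 0) * e (n - Suc i) 1)"
    by (rule last_exit_recursion[where m = "1 + t"]) (auto simp: e_0 e_step, simp add: e_def)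
  then show ?thesis using e_step[of n 0] t by (simp add: e_def[of _ 0] flip: mult.assoc)
qed

text \<open>One factor of \<open>g\<close> cancels the denominator of the density, which leaves the
  integral defining \<open>e n 1\<close>.\<close>

private lemma moment_Suc: "(LINT x|marchenko_pastur t. x ^ Suc n) = t * e n 1"
proof -
  let ?h = "\<lambda>\<theta>. 2 * t / pi * (g \<theta> ^ n * (sin \<theta> * sin \<theta>))"
  \<comment> \<open>The cancellation is also valid where \<open>g\<close> vanishes, since the
    squared sine vanishes there: \<open>g\<close> is a sum of two squares, one of them that of the
    sine.\<close>
  have gz: "sin \<theta> = 0" if "g \<theta> = 0" for \<theta>
  proof -
    have "g \<theta> = (sqrt t - cos \<theta>)\<^sup>2 + (sin \<theta>)\<^sup>2"
      using t by (simp add: g_def power2_eq_square sin_squared_eq[unfolded power2_eq_square] algebra_simps)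
    then show ?thesis using that by (simp add: add_nonneg_eq_0_iff)
  qed
  have "(LINT x|marchenko_pastur t. x ^ Suc n) =
      (LINT \<theta>|lborel. g \<theta> ^ Suc n * (2 * t * (sin \<theta>)\<^sup>2 / (pi * g \<theta>)) * indicator {0..pi} \<theta>)"
    using marchenko_pastur_moment_trig[OF t, of "Suc n"] by (simp add: g_def)
  also have "\<dots> = (LINT \<theta>:{0..pi}|lborel. ?h \<theta>)"
    unfolding set_lebesgue_integral_def
    by (intro Bochner_Integration.integral_cong)
       (auto simp: indicator_def power2_eq_square dest: gz)
  also have "\<dots> = integral {0..pi} ?h"
    by (intro set_borel_integral_eq_integral borel_integrable_atLeastAtMost'
          continuous_intros cont_g)
  also have "\<dots> = t * e n 1" by (simp add: e_def)
  finally show ?thesis .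
qed

text \<open>Here 1/g survives. For t = 1 the quotient is (1 + cos \<theta>) / pi, with an explicit
  antiderivative. For t > 1 the integrals \<open>J j\<close> satisfy a linear recursion with
  characteristic roots s and 1/s, and boundedness excludes the growing root.\<close>

lemma marchenko_pastur_moment_0: "(LINT x|marchenko_pastur t. x ^ 0) = 1"
proof (cases "t = 1")
  case True
  let ?h = "\<lambda>\<theta>. (1 + cos \<theta>) / pi"
  have "cos \<theta> \<noteq> 1" if "0 < \<theta>" "\<theta> \<le> pi" for \<theta>
    using that cos_monotone_0_pi[of 0 \<theta>] by simp
  \<comment> \<open>At \<theta> = 0 the left side is 0 by the convention for division by zero while
    the right side is \<open>2 / pi\<close>, hence an equality almost everywhere.\<close>
  then have eq: "2 * t * (sin \<theta>)\<^sup>2 / (pi * g \<theta>) * indicator {0..pi} \<theta> = ?h \<theta> * indicator {0..pi} \<theta>"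
    if "\<theta> \<noteq> 0" for \<theta>
  proof (cases "\<theta> \<in> {0..pi}")
    case inside: True
    then have "1 - cos \<theta> \<noteq> 0" using \<open>\<And>\<theta>. \<lbrakk>0 < \<theta>; \<theta> \<le> pi\<rbrakk> \<Longrightarrow> cos \<theta> \<noteq> 1\<close>[of \<theta>] that by simp
    moreover have "(sin \<theta>)\<^sup>2 = (1 + cos \<theta>) * (1 - cos \<theta>)"
      by (simp add: sin_squared_eq power2_eq_square algebra_simps)
    moreover have "g \<theta> = 2 * (1 - cos \<theta>)" unfolding g_def using True by simp
    moreover have "2 * 1 * (u * v) / (pi * (2 * v)) = u / pi" if "v \<noteq> 0" for u v :: real
      using that by (simp add: field_simps)
    note this[OF \<open>1 - cos \<theta> \<noteq> 0\<close>, of "1 + cos \<theta>"]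
    ultimately show ?thesis unfolding \<open>t = 1\<close> by (simp only:)
  qed simp
  have "(LINT x|marchenko_pastur t. x ^ 0) =
      (LINT \<theta>|lborel. 2 * t * (sin \<theta>)\<^sup>2 / (pi * g \<theta>) * indicator {0..pi} \<theta>)"
    using marchenko_pastur_moment_trig[OF t, of 0] by (simp add: g_def)
  also have "\<dots> = (LINT \<theta>|lborel. ?h \<theta> * indicator {0..pi} \<theta>)"
  proof (intro integral_cong_AE)
    show "AE \<theta> in lborel. 2 * t * (sin \<theta>)\<^sup>2 / (pi * g \<theta>) * indicator {0..pi} \<theta> = ?h \<theta> * indicator {0..pi} \<theta>"
      using AE_lborel_singleton[of 0] by eventually_elim (rule eq)
  qed (auto simp: g_def)
  also have "\<dots> = (LINT \<theta>:{0..pi}|lborel. ?h \<theta>)"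
    unfolding set_lebesgue_integral_def by (simp add: mult.commute)
  also have "\<dots> = integral {0..pi} ?h"
    by (intro set_borel_integral_eq_integral borel_integrable_atLeastAtMost' continuous_intros) simp
  also have "(?h has_integral ((pi + sin pi) / pi - (0 + sin 0) / pi)) {0..pi}"
    by (intro fundamental_theorem_of_calculus)
       (auto intro!: derivative_eq_intros simp flip: has_real_derivative_iff_has_vector_derivative)
  then have "integral {0..pi} ?h = 1" by (auto dest: integral_unique)
  finally show ?thesis .
next
  case False
  define s where "s = sqrt t"
  have s: "s > 1" "s * s = t" using t False by (auto simp: s_def)
  have gpos: "g \<theta> > 0" for \<theta>
  proof -
    have "(1 - s)\<^sup>2 + 2 * s * (1 - cos \<theta>) > 0"
      using s by (intro add_pos_nonneg mult_nonneg_nonneg) auto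
    then show ?thesis using s by (simp add: g_def s_def[symmetric] power2_eq_square algebra_simps)
  qed
  then have gnz: "g \<theta> \<noteq> 0" for \<theta> by (metis less_irrefl)
  define J where "J j = integral {0..pi} (\<lambda>\<theta>. sin (real j * \<theta>) * sin \<theta> / g \<theta>)" for j
  have i: "(\<lambda>\<theta>. sin (real j * \<theta>) * sin \<theta> / g \<theta>) integrable_on {0..pi}" for j
    by (intro integrable_continuous_interval continuous_intros cont_g ballI gnz)
  have rec: "(1 + t) * J (Suc j) - s * (J (Suc (Suc j)) + J j) = (if j = 0 then pi / 2 else 0)" for j
  proof -
    let ?I = "\<lambda>j \<theta>. sin (real j * \<theta>) * sin \<theta> / g \<theta>"
    have "sin (real (Suc j) * \<theta>) * sin \<theta> = (1 + t) * ?I (Suc j) \<theta> - s * (?I (Suc (Suc j)) \<theta> + ?I j \<theta>)" for \<theta>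
    proof -
      have "sin (real (Suc j) * \<theta>) * sin \<theta> =
          ((1 + t) - s * (2 * cos \<theta>)) * (sin (real (Suc j) * \<theta>) * sin \<theta>) / g \<theta>"
        using gnz[of \<theta>] by (simp add: g_def s_def field_simps)
      also have "\<dots> = (1 + t) * ?I (Suc j) \<theta> - s * ((2 * cos \<theta> * sin (real (Suc j) * \<theta>)) * sin \<theta> / g \<theta>)"
        by (simp add: diff_divide_distrib algebra_simps)
      finally show ?thesis unfolding two_cos_mult_sin by (simp add: algebra_simps add_divide_distrib)
    qed
    then have "integral {0..pi} (\<lambda>\<theta>. sin (real (Suc j) * \<theta>) * sin \<theta>) =
        integral {0..pi} (\<lambda>\<theta>. (1 + t) * ?I (Suc j) \<theta> - s * (?I (Suc (Suc j)) \<theta> + ?I j \<theta>))"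
      by presburger
    also have "\<dots> = (1 + t) * J (Suc j) - s * (J (Suc (Suc j)) + J j)"
      unfolding J_def
      by (intro integral_unique has_integral_diff has_integral_add has_integral_mult_right
            integrable_integral i)
    finally show ?thesis using integral_unique[OF integral_sin_mult_sin[of "Suc j"]] by simp
  qed
  define B where "B = integral {0..pi} (\<lambda>\<theta>. 1 / g \<theta>)"
  have bd: "\<bar>J j\<bar> \<le> B" for j
    unfolding J_def B_def real_norm_def[symmetric]
  proof (intro integral_norm_bound_integral i)
    show "(\<lambda>\<theta>. 1 / g \<theta>) integrable_on {0..pi}"
      by (intro integrable_continuous_interval continuous_intros cont_g ballI gnz)
    fix \<theta>
    have "\<bar>sin (real j * \<theta>)\<bar> * \<bar>sin \<theta>\<bar> \<le> 1 * 1" by (intro mult_mono) auto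
    then show "norm (sin (real j * \<theta>) * sin \<theta> / g \<theta>) \<le> 1 / g \<theta>"
      using gpos[of \<theta>] by (simp add: abs_mult divide_right_mono)
  qed
  \<comment> \<open>This combination annihilates the solution with root 1/s and isolates the one
    with root s, so it is multiplied by s at each step.\<close>
  define K where "K j = s * J (Suc (Suc j)) - J (Suc j)" for j
  have "K (Suc j) = s * K j" for j
    using rec[of "Suc j"] unfolding K_def s(2)[symmetric] by (simp add: algebra_simps)
  then have K: "K j = s ^ j * K 0" for j by (induction j) auto
  have Kbd: "\<bar>K j\<bar> \<le> s * B + B" for j
  proof -
    have "\<bar>K j\<bar> \<le> s * \<bar>J (Suc (Suc j))\<bar> + \<bar>J (Suc j)\<bar>"
      unfolding K_def using s abs_triangle_ineq4[of "s * J (Suc (Suc j))" "J (Suc j)"]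
      by (simp add: abs_mult)
    also have "\<dots> \<le> s * B + B" using s bd by (intro add_mono mult_left_mono) auto
    finally show ?thesis .
  qed
  have "K 0 = 0"
  proof (rule ccontr)
    assume nz: "K 0 \<noteq> 0"
    obtain j where "(s * B + B) / \<bar>K 0\<bar> < s ^ j" using real_arch_pow[OF s(1)] by blast
    then have "s * B + B < \<bar>K j\<bar>" using nz s by (subst K) (simp add: field_simps abs_mult)
    then show False using Kbd[of j] by simp
  qed
  then have J: "t * J 1 = pi / 2"
    using rec[of 0] s by (simp add: K_def J_def[of 0] algebra_simps)
  have "(LINT x|marchenko_pastur t. x ^ 0) =
      (LINT \<theta>|lborel. 2 * t * (sin \<theta>)\<^sup>2 / (pi * g \<theta>) * indicator {0..pi} \<theta>)"
    using marchenko_pastur_moment_trig[OF t, of 0] by (simp add: g_def)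
  also have "\<dots> = (LINT \<theta>:{0..pi}|lborel. 2 * t / pi * (sin \<theta> * sin \<theta> / g \<theta>))"
    unfolding set_lebesgue_integral_def by (simp add: mult.commute power2_eq_square)
  also have "\<dots> = integral {0..pi} (\<lambda>\<theta>. 2 * t / pi * (sin \<theta> * sin \<theta> / g \<theta>))"
    by (intro set_borel_integral_eq_integral borel_integrable_atLeastAtMost' continuous_intros
          cont_g ballI gnz)
  also have "\<dots> = 2 / pi * (t * J 1)" by (subst integral_mult_right) (simp add: J_def)
  also have "\<dots> = 1" unfolding J by simp
  finally show ?thesis .
qed

text \<open>For positive n the two end terms of the convolution contribute twice the n-th moment,
  which accounts for the passage from \<open>1 + t\<close> in \<open>e_1_recursion\<close> to
  \<open>t - 1\<close>.\<close>

lemma marchenko_pastur_moment_Suc: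
  "(LINT x|marchenko_pastur t. x ^ Suc n) =
     (\<Sum>j\<le>n. (LINT x|marchenko_pastur t. x ^ j) * (LINT x|marchenko_pastur t. x ^ (n - j)))
     + (t - 1) * (LINT x|marchenko_pastur t. x ^ n)"
proof (cases n)
  case 0
  then show ?thesis using moment_Suc[of 0] marchenko_pastur_moment_0 by (simp add: e_0 del: power_0)
next
  case (Suc k)
  define M where "M n = (LINT x|marchenko_pastur t. x ^ n)" for n
  have M: "M 0 = 1" "\<And>n. M (Suc n) = t * e n 1"
    unfolding M_def by (rule marchenko_pastur_moment_0, rule moment_Suc)
  have "(\<Sum>j\<le>Suc k. M j * M (Suc k - j)) =
      M (Suc k) + (\<Sum>j<k. M (Suc j) * M (k - j)) + M (Suc k)"
    unfolding sum.atMost_Suc_shift unfolding lessThan_Suc_atMost[symmetric] sum.lessThan_Suc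
    by (simp add: M(1))
  also have "(\<Sum>j<k. M (Suc j) * M (k - j)) = (\<Sum>j<k. M (Suc j) * M (Suc (k - Suc j)))"
    by (intro sum.cong) (auto simp: Suc_diff_Suc)
  also have "\<dots> = t * (t * (\<Sum>j<k. e j 1 * e (k - Suc j) 1))"
    unfolding M by (simp add: sum_distrib_left mult_ac)
  finally have "M (Suc (Suc k)) = (\<Sum>j\<le>Suc k. M j * M (Suc k - j)) + (t - 1) * M (Suc k)"
    unfolding M(2)[of "Suc k"] e_1_recursion M(2)[of k] by (simp add: algebra_simps)
  then show ?thesis unfolding Suc M_def .
qed

end

section \<open>Tracial states\<close>

lemma scaleC_one: "1 *\<^sub>C x = (x::'a::cstar_algebra)"
  using scaleC_of_real[of 1 x] by simp

lemma scaleC_zero_right: "c *\<^sub>C 0 = (0::'a::cstar_algebra)"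
  using scaleC_add_right[of c 0 "0::'a"] by simp

lemma star_zero: "star 0 = (0::'a::cstar_algebra)"
  using star_add[of 0 "0::'a"] by simp

lemma star_one: "star 1 = (1::'a::cstar_algebra)"
  by (metis mult.right_neutral star_mult star_star)

lemma star_power: "star (x ^ n) = star (x::'a::cstar_algebra) ^ n"
  by (induction n) (auto simp: star_one star_mult power_commutes)

lemma power_mult_swap: "(u * v) ^ n * u = u * (v * u :: 'a::monoid_mult) ^ n"
  by (induction n) (simp_all add: mult.assoc)

locale tracial_state =
  fixes \<phi> :: "'a::cstar_algebra \<Rightarrow> complex"
  assumes bounded_linear: "bounded_linear \<phi>"
    and scaleC: "\<phi> (c *\<^sub>C x) = c * \<phi> x"
    and unit: "\<phi> 1 = 1"
    and positive: "\<phi> (star x * x) \<in> \<real>\<^sub>\<ge>\<^sub>0"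
    and faithful: "\<phi> (star x * x) = 0 \<Longrightarrow> x = 0"
    and trace: "\<phi> (x * y) = \<phi> (y * x)"

lemma tracial_stateI: "tracial_wstar_prob_space \<phi> \<Longrightarrow> tracial_state \<phi>"
  unfolding tracial_wstar_prob_space_def is_predual_def tracial_state_def
  by (auto intro: blinfun.bounded_linear_right)

context tracial_state
begin

lemmas linear = Real_Vector_Spaces.bounded_linear.linear[OF bounded_linear]
lemmas add = linear_add[OF linear]
  and diff = linear_diff[OF linear]
  and zero = linear_0[OF linear]

lemma scaleR: "\<phi> (r *\<^sub>R x) = complex_of_real r * \<phi> x"
  using scaleC[of "complex_of_real r" x] by (simp add: scaleC_of_real)

lemma Im_positive: "Im (\<phi> (star x * x)) = 0" and Re_positive: "Re (\<phi> (star x * x)) \<ge> 0"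
  using positive[of x] by (auto simp: complex_nonneg_Reals_iff)

text \<open>Positivity makes \<phi> (\<open>star y * y\<close>) real; the choices y = x + 1 and y =
  x + \<i> compare the imaginary and the real parts.\<close>

lemma hermitian: "\<phi> (star x) = cnj (\<phi> x)"
proof (rule complex_eqI)
  have "\<phi> (star (x + 1) * (x + 1)) = \<phi> (star x * x) + \<phi> x + \<phi> (star x) + 1"
    by (simp add: star_add star_one algebra_simps add unit)
  then show "Im (\<phi> (star x)) = Im (cnj (\<phi> x))"
    using Im_positive[of x] Im_positive[of "x + 1"] by simp
  have "\<phi> (star (x + \<i> *\<^sub>C 1) * (x + \<i> *\<^sub>C 1)) = \<phi> (star x * x) + \<i> * \<phi> (star x) - \<i> * \<phi> x + 1"
    by (simp add: star_add star_one star_scaleC scaleC_mult_left scaleC_mult_right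
          algebra_simps add unit scaleC_scaleC scaleC_one scaleC)
  then show "Re (\<phi> (star x)) = Re (cnj (\<phi> x))"
    using Im_positive[of x] Im_positive[of "x + \<i> *\<^sub>C 1"] by simp
qed

section \<open>The real inner product and the 2-norm\<close>

text \<open>Taking the real part makes Cauchy-Schwarz a statement about a real quadratic form; the
  complex bound follows by a rotation. The star is on the second factor to match
  \<open>norm2\<close>.\<close>

definition ip :: "'a \<Rightarrow> 'a \<Rightarrow> real" where
  "ip x y = Re (\<phi> (x * star y))"

lemma ip_commute: "ip x y = ip y x"
  using hermitian[of "x * star y"] by (simp add: ip_def star_mult star_star)

lemma ip_add_left: "ip (x + y) z = ip x z + ip y z"
  and ip_diff_left: "ip (x - y) z = ip x z - ip y z"
  and ip_scaleR_left: "ip (r *\<^sub>R x) z = r * ip x z"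
  by (simp_all add: ip_def distrib_right left_diff_distrib add diff scaleR)

lemma ip_add_right: "ip z (x + y) = ip z x + ip z y"
  and ip_diff_right: "ip z (x - y) = ip z x - ip z y"
  and ip_scaleR_right: "ip z (r *\<^sub>R x) = r * ip z x"
  by (simp_all add: ip_commute[of z] ip_add_left ip_diff_left ip_scaleR_left)

lemmas ip_simps = ip_add_left ip_diff_left ip_scaleR_left ip_add_right ip_diff_right ip_scaleR_right

lemma ip_nonneg: "ip x x \<ge> 0"
  using Re_positive[of "star x"] by (simp add: ip_def star_star)

lemma ip_eq_0_iff: "ip x x = 0 \<longleftrightarrow> x = 0"
proof
  assume "ip x x = 0"
  then have "\<phi> (star (star x) * star x) = 0"
    using Im_positive[of "star x"] by (auto simp: ip_def star_star complex_eq_iff)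
  then have "star x = 0" by (rule faithful)
  then show "x = 0" by (metis star_star star_zero)
qed (simp add: ip_def zero)

lemma norm2_squared: "(norm2 \<phi> x)\<^sup>2 = ip x x"
  using ip_nonneg[of x] by (simp add: norm2_def ip_def)

lemma norm2_nonneg: "norm2 \<phi> x \<ge> 0"
  using ip_nonneg[of x] by (simp add: norm2_def ip_def)

lemma norm2_eq_0_iff: "norm2 \<phi> x = 0 \<longleftrightarrow> x = 0"
  using norm2_squared[of x] ip_eq_0_iff[of x] by auto

lemma norm2_0: "norm2 \<phi> 0 = 0"
  by (simp add: norm2_eq_0_iff)

lemma self_adjoint_state: "\<phi> (x * star x) = complex_of_real ((norm2 \<phi> x)\<^sup>2)"
  using Im_positive[of "star x"] by (simp add: norm2_squared ip_def star_star complex_eq_iff)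

lemma norm2_star: "norm2 \<phi> (star x) = norm2 \<phi> x"
  by (simp add: norm2_def star_star trace)

lemma norm2_scaleC: "norm2 \<phi> (c *\<^sub>C x) = cmod c * norm2 \<phi> x"
proof -
  have "\<phi> (c *\<^sub>C x * star (c *\<^sub>C x)) = (c * cnj c) * \<phi> (x * star x)"
    by (simp add: star_scaleC scaleC_mult_left scaleC_mult_right scaleC)
  also have "c * cnj c = complex_of_real ((cmod c)\<^sup>2)"
    using complex_norm_square[of c] by simp
  finally show ?thesis
    by (simp add: norm2_def real_sqrt_mult)
qed

lemma norm2_scaleR: "norm2 \<phi> (r *\<^sub>R x) = \<bar>r\<bar> * norm2 \<phi> x"
  using norm2_scaleC[of "complex_of_real r" x] by (simp add: scaleC_of_real)

lemma Cauchy_Schwarz: "\<bar>ip x y\<bar> \<le> norm2 \<phi> x * norm2 \<phi> y"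
proof (cases "y = 0")
  case True
  then show ?thesis by (simp add: ip_def star_zero zero norm2_0)
next
  case False
  then have y: "ip y y > 0" using ip_nonneg[of y] ip_eq_0_iff[of y] by simp
  define t where "t = ip x y / ip y y"
  have "0 \<le> ip (x - t *\<^sub>R y) (x - t *\<^sub>R y)" by (rule ip_nonneg)
  also have "\<dots> = ip x x - (ip x y)\<^sup>2 / ip y y"
    using y by (simp add: ip_simps ip_commute[of y x] t_def power2_eq_square field_simps)
  finally have "(ip x y)\<^sup>2 \<le> (norm2 \<phi> x * norm2 \<phi> y)\<^sup>2"
    using y by (simp add: power_mult_distrib norm2_squared field_simps)
  then show ?thesis
    by (metis abs_le_square_iff abs_mult abs_of_nonneg norm2_nonneg)
qed

lemma norm2_triangle: "norm2 \<phi> (x + y) \<le> norm2 \<phi> x + norm2 \<phi> y"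
proof (rule power2_le_imp_le)
  show "(norm2 \<phi> (x + y))\<^sup>2 \<le> (norm2 \<phi> x + norm2 \<phi> y)\<^sup>2"
    using Cauchy_Schwarz[of x y]
    by (simp add: norm2_squared power2_sum ip_simps ip_commute[of y x])
qed (simp add: norm2_nonneg)

lemma norm2_minus_commute: "norm2 \<phi> (x - y) = norm2 \<phi> (y - x)"
  using norm2_scaleR[of "-1" "x - y"] by simp

lemma norm2_triangle_diff: "norm2 \<phi> (x - z) \<le> norm2 \<phi> (x - y) + norm2 \<phi> (y - z)"
  using norm2_triangle[of "x - y" "y - z"] by simp

lemma norm2_diff_abs: "\<bar>norm2 \<phi> x - norm2 \<phi> y\<bar> \<le> norm2 \<phi> (x - y)"
  using norm2_triangle[of "x - y" y] norm2_triangle[of "y - x" x] norm2_minus_commute[of x y]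
  by simp

lemma complex_Cauchy_Schwarz: "cmod (\<phi> (x * star y)) \<le> norm2 \<phi> x * norm2 \<phi> y"
proof (cases "\<phi> (x * star y) = 0")
  case False
  define z where "z = \<phi> (x * star y)"
  \<comment> \<open>The unimodular factor that rotates \<open>z\<close> onto the positive
    half-line.\<close>
  define c where "c = cnj z / cmod z"
  have "cmod c = 1" using False by (simp add: c_def z_def norm_divide)
  have "ip (c *\<^sub>C x) y = Re (c * z)"
    by (simp add: ip_def z_def scaleC_mult_left scaleC)
  also have "c * z = complex_of_real (cmod z)"
    using False complex_norm_square[of z] by (simp add: c_def z_def power2_eq_square field_simps)
  finally show ?thesis
    using Cauchy_Schwarz[of "c *\<^sub>C x" y] by (simp add: norm2_scaleC \<open>cmod c = 1\<close> z_def)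
qed (simp add: norm2_nonneg)

lemma cmod_state_le: "cmod (\<phi> x) \<le> norm2 \<phi> x"
  using complex_Cauchy_Schwarz[of x 1] by (simp add: star_one norm2_def unit)

section \<open>Boundedness of multiplication in the 2-norm\<close>

text \<open>
  Without functional calculus: by the Cauchy--Schwarz inequality the numbers
  \<open>F n = \<phi> (y h\<^bsup>2^n\<^esup> y\<^sup>*)\<close> satisfy \<open>(F n)\<^sup>2 \<le> F (n + 1) F\<close>, where \<open>F = \<phi> (y y\<^sup>*)\<close>,
  whereas boundedness of \<open>\<phi>\<close> gives only exponential growth at rate \<open>norm h\<close>.
\<close>

lemma conjugated_state_le:
  assumes h: "star h = h"
  shows "Re (\<phi> (y * h * star y)) \<le> norm h * ip y y"
proof (cases "y = 0 \<or> h = 0")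
  case True
  then show ?thesis by (auto simp: zero ip_nonneg)
next
  case False
  then have T: "ip y y > 0" and hpos: "norm h > 0"
    using ip_nonneg[of y] ip_eq_0_iff[of y] by auto
  \<comment> \<open>Division by \<open>ip y y\<close> turns the Cauchy-Schwarz estimate into
    \<open>(G n)\<^sup>2 \<le> G (Suc n)\<close>.\<close>
  define G where "G n = Re (\<phi> (y * h ^ (2 ^ n) * star y)) / ip y y" for n :: nat
  have sq: "(G n)\<^sup>2 \<le> G (Suc n)" for n
  proof -
    define m where "m = (2::nat) ^ n"
    have "(ip (y * h ^ m) y)\<^sup>2 \<le> (norm2 \<phi> (y * h ^ m) * norm2 \<phi> y)\<^sup>2"
      using Cauchy_Schwarz[of "y * h ^ m" y] by (simp add: abs_le_square_iff[symmetric] norm2_nonneg)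
    also have "\<dots> = Re (\<phi> (y * h ^ (2 * m) * star y)) * ip y y"
      by (simp add: power_mult_distrib norm2_squared)
         (simp add: ip_def star_mult star_power h mult.assoc power_add mult_2)
    finally have "(Re (\<phi> (y * h ^ m * star y)))\<^sup>2 \<le> Re (\<phi> (y * h ^ (2 * m) * star y)) * ip y y"
      by (simp add: ip_def)
    then show ?thesis
      using T by (simp add: G_def m_def power2_eq_square field_simps)
  qed
  obtain K where K: "\<And>x. cmod (\<phi> x) \<le> norm x * K"
    using Real_Vector_Spaces.bounded_linear.bounded[OF bounded_linear] by blast
  then have "K \<ge> 0" using K[of 1] by (simp add: unit)
  define C where "C = norm y * norm (star y) * K / ip y y"
  have upper: "G n \<le> C * norm h ^ (2 ^ n)" for n
  proof -
    have "norm (y * h ^ (2 ^ n) * star y) \<le> norm y * norm h ^ (2 ^ n) * norm (star y)"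
      by (meson mult_mono norm_ge_zero norm_mult_ineq norm_power_ineq order_refl order_trans mult_nonneg_nonneg)
    then have "norm (y * h ^ (2 ^ n) * star y) * K \<le> norm y * norm h ^ (2 ^ n) * norm (star y) * K"
      using \<open>K \<ge> 0\<close> by (rule mult_right_mono)
    moreover have "Re (\<phi> (y * h ^ (2 ^ n) * star y)) \<le> norm (y * h ^ (2 ^ n) * star y) * K"
      using K complex_Re_le_cmod order_trans by blast
    ultimately show ?thesis
      using T by (simp add: G_def C_def field_simps)
  qed
  \<comment> \<open>Otherwise repeated squaring gives \<open>G n\<close> at least
    \<open>G 0 ^ (2 ^ n)\<close>, which outgrows the upper bound
    \<open>C * norm h ^ (2 ^ n)\<close>.\<close>
  have "G 0 \<le> norm h"
  proof (rule ccontr)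
    assume "\<not> G 0 \<le> norm h"
    then have less: "norm h < G 0" by simp
    have lower: "G 0 ^ (2 ^ n) \<le> G n" for n
    proof (induction n)
      case (Suc n)
      have "G 0 ^ (2 ^ Suc n) = (G 0 ^ (2 ^ n))\<^sup>2" by (simp add: power_mult[symmetric] mult.commute)
      also have "\<dots> \<le> (G n)\<^sup>2" using Suc order_trans[OF norm_ge_zero less_imp_le[OF less]] by (intro power_mono zero_le_power)
      also have "\<dots> \<le> G (Suc n)" by (rule sq)
      finally show ?case .
    qed simp
    have q: "1 < G 0 / norm h" using less hpos by simp
    obtain j where "C < (G 0 / norm h) ^ j" using real_arch_pow[OF q] by blast
    also have "\<dots> \<le> (G 0 / norm h) ^ (2 ^ j)"
      using q by (intro power_increasing) auto
    also have "\<dots> \<le> C"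
      using order_trans[OF lower upper, of j] hpos by (simp add: power_divide field_simps)
    finally show False by simp
  qed
  then show ?thesis using T by (simp add: G_def field_simps)
qed

text \<open>The estimate behind the bimodule structure of the completion. It is the preceding bound
  for \<open>h = b * star b\<close>, whose norm the C*-identity for \<open>star b\<close>
  evaluates.\<close>

lemma norm2_mult_right: "norm2 \<phi> (x * b) \<le> norm (star b) * norm2 \<phi> x"
proof (rule power2_le_imp_le)
  have "(norm2 \<phi> (x * b))\<^sup>2 = Re (\<phi> (x * (b * star b) * star x))"
    by (simp add: norm2_squared ip_def star_mult mult.assoc)
  also have "\<dots> \<le> norm (b * star b) * ip x x"
    by (rule conjugated_state_le) (simp add: star_mult star_star)
  also have "norm (b * star b) = (norm (star b))\<^sup>2"
    using cstar_identity[of "star b"] by (simp add: star_star)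
  finally show "(norm2 \<phi> (x * b))\<^sup>2 \<le> (norm (star b) * norm2 \<phi> x)\<^sup>2"
    by (simp add: power_mult_distrib norm2_squared)
qed (simp add: norm2_nonneg)

lemma norm2_mult_left: "norm2 \<phi> (b * x) \<le> norm b * norm2 \<phi> x"
  using norm2_mult_right[of "star x" "star b"] norm2_star[of "b * x"]
  by (simp add: star_mult star_star norm2_star)

lemma norm2_mult_both: "norm2 \<phi> (a * x * b) \<le> norm a * norm (star b) * norm2 \<phi> x"
proof -
  have "norm2 \<phi> (a * x * b) \<le> norm (star b) * norm2 \<phi> (a * x)" by (rule norm2_mult_right)
  also have "\<dots> \<le> norm (star b) * (norm a * norm2 \<phi> x)"
    by (intro mult_left_mono norm2_mult_left) simp
  finally show ?thesis by (simp add: mult_ac)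
qed

section \<open>Calculus in the completion\<close>

lemma cauchy2_const: "(\<lambda>n. a) \<in> cauchy2 \<phi>"
  by (simp add: cauchy2_def norm2_0)

lemma cauchy2D:
  "x \<in> cauchy2 \<phi> \<Longrightarrow> e > 0 \<Longrightarrow> \<exists>N. \<forall>m\<ge>N. \<forall>n\<ge>N. norm2 \<phi> (x m - x n) < e"
  unfolding cauchy2_def by blast

lemma cauchy2_diff:
  assumes "x \<in> cauchy2 \<phi>" "y \<in> cauchy2 \<phi>"
  shows "(\<lambda>n. x n - y n) \<in> cauchy2 \<phi>"
  unfolding cauchy2_def
proof safe
  fix e :: real assume "e > 0"
  then obtain N1 N2 where N: "\<forall>m\<ge>N1. \<forall>n\<ge>N1. norm2 \<phi> (x m - x n) < e / 2"
      "\<forall>m\<ge>N2. \<forall>n\<ge>N2. norm2 \<phi> (y m - y n) < e / 2"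
    using cauchy2D[OF assms(1), of "e / 2"] cauchy2D[OF assms(2), of "e / 2"] by auto
  have "norm2 \<phi> (x m - y m - (x n - y n)) < e" if "m \<ge> max N1 N2" "n \<ge> max N1 N2" for m n
  proof -
    have "norm2 \<phi> (x m - y m - (x n - y n)) \<le> norm2 \<phi> (x m - x n) + norm2 \<phi> (y n - y m)"
      using norm2_triangle[of "x m - x n" "y n - y m"] by (simp add: algebra_simps)
    also have "\<dots> < e / 2 + e / 2" using that N by (intro add_strict_mono) auto
    finally show ?thesis by simp
  qed
  then show "\<exists>N. \<forall>m\<ge>N. \<forall>n\<ge>N. norm2 \<phi> (x m - y m - (x n - y n)) < e" by blast
qed

lemma cauchy2_mult:
  assumes "x \<in> cauchy2 \<phi>"
  shows "(\<lambda>n. a * x n * b) \<in> cauchy2 \<phi>"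
  unfolding cauchy2_def
proof safe
  fix e :: real assume "e > 0"
  \<comment> \<open>The added 1 keeps the divisor of \<open>e\<close> positive when a factor is
    zero.\<close>
  define C where "C = norm a * norm (star b) + 1"
  have "C > 0" unfolding C_def by (intro add_nonneg_pos) auto
  then obtain N where N: "\<forall>m\<ge>N. \<forall>n\<ge>N. norm2 \<phi> (x m - x n) < e / C"
    using cauchy2D[OF assms, of "e / C"] \<open>e > 0\<close> by auto
  have "norm2 \<phi> (a * x m * b - a * x n * b) < e" if "m \<ge> N" "n \<ge> N" for m n
  proof -
    have "norm2 \<phi> (a * x m * b - a * x n * b) = norm2 \<phi> (a * (x m - x n) * b)"
      by (simp add: algebra_simps)
    also have "\<dots> \<le> norm a * norm (star b) * norm2 \<phi> (x m - x n)" by (rule norm2_mult_both)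
    also have "\<dots> \<le> C * norm2 \<phi> (x m - x n)"
      unfolding C_def by (intro mult_right_mono) (auto simp: norm2_nonneg)
    also have "\<dots> < C * (e / C)" using N that \<open>C > 0\<close> by (intro mult_strict_left_mono) auto
    finally show ?thesis using \<open>C > 0\<close> by simp
  qed
  then show "\<exists>N. \<forall>m\<ge>N. \<forall>n\<ge>N. norm2 \<phi> (a * x m * b - a * x n * b) < e" by blast
qed

lemma null_mult:
  assumes "(\<lambda>n. norm2 \<phi> (x n)) \<longlonglongrightarrow> 0"
  shows "(\<lambda>n. norm2 \<phi> (a * x n * b)) \<longlonglongrightarrow> 0"
proof (rule Lim_null_comparison)
  show "\<forall>\<^sub>F n in sequentially. norm (norm2 \<phi> (a * x n * b)) \<le> norm a * norm (star b) * norm2 \<phi> (x n)"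
    by (simp add: norm2_mult_both norm2_nonneg)
  show "(\<lambda>n. norm a * norm (star b) * norm2 \<phi> (x n)) \<longlonglongrightarrow> 0"
    by (intro tendsto_mult_right_zero assms)
qed

lemma null_triangle:
  assumes "(\<lambda>n. norm2 \<phi> (x n - y n)) \<longlonglongrightarrow> 0" "(\<lambda>n. norm2 \<phi> (y n - z n)) \<longlonglongrightarrow> 0"
  shows "(\<lambda>n. norm2 \<phi> (x n - z n)) \<longlonglongrightarrow> 0"
proof (rule Lim_null_comparison)
  show "(\<lambda>n. norm2 \<phi> (x n - y n) + norm2 \<phi> (y n - z n)) \<longlonglongrightarrow> 0"
    using tendsto_add[OF assms] by simp
qed (auto simp: norm2_nonneg norm2_triangle_diff)

lemma null_sym: "(\<lambda>n. norm2 \<phi> (x n - y n)) \<longlonglongrightarrow> 0 \<Longrightarrow> (\<lambda>n. norm2 \<phi> (y n - x n)) \<longlonglongrightarrow> 0"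
  by (simp add: norm2_minus_commute)

section \<open>Classes and independence of representatives\<close>

abbreviation cls :: "(nat \<Rightarrow> 'a) \<Rightarrow> (nat \<Rightarrow> 'a) set" where
  "cls x \<equiv> null2_rel \<phi> `` {x}"

lemma equiv_null2_rel: "equiv (cauchy2 \<phi>) (null2_rel \<phi>)"
proof (rule equivI)
  show "null2_rel \<phi> \<subseteq> cauchy2 \<phi> \<times> cauchy2 \<phi>" by (auto simp: null2_rel_def)
  show "refl_on (cauchy2 \<phi>) (null2_rel \<phi>)"
    by (auto simp: refl_on_def null2_rel_def norm2_0)
  show "sym (null2_rel \<phi>)" by (auto simp: sym_def null2_rel_def intro: null_sym)
  show "trans (null2_rel \<phi>)" by (auto simp: trans_def null2_rel_def intro: null_triangle)
qed

lemma cls_eq_iff: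
  "x \<in> cauchy2 \<phi> \<Longrightarrow> y \<in> cauchy2 \<phi> \<Longrightarrow> cls x = cls y \<longleftrightarrow> (\<lambda>n. norm2 \<phi> (x n - y n)) \<longlonglongrightarrow> 0"
  by (subst eq_equiv_class_iff[OF equiv_null2_rel]) (auto simp: null2_rel_def)

lemma cls_in_L2: "x \<in> cauchy2 \<phi> \<Longrightarrow> cls x \<in> L2 \<phi>"
  unfolding L2_def by (rule quotientI)

lemma L2_cases:
  assumes "\<xi> \<in> L2 \<phi>" obtains x where "x \<in> cauchy2 \<phi>" "\<xi> = cls x"
  using assms unfolding L2_def by (auto elim: quotientE)

lemma L2_embed_eq: "L2_embed \<phi> a = cls (\<lambda>n. a)"
  by (simp add: L2_embed_def)

text \<open>All operations on the completion are defined through an arbitrarily chosen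
  representative. This is the only information about that choice which the later computations
  use.\<close>

lemma L2_rep_cls:
  assumes "x \<in> cauchy2 \<phi>"
  shows "L2_rep (cls x) \<in> cauchy2 \<phi>" "(\<lambda>n. norm2 \<phi> (L2_rep (cls x) n - x n)) \<longlonglongrightarrow> 0"
proof -
  have "x \<in> cls x" using assms by (simp add: null2_rel_def norm2_0)
  then have "L2_rep (cls x) \<in> cls x" unfolding L2_rep_def by (rule someI[where P = "\<lambda>y. y \<in> cls x"])
  then show "L2_rep (cls x) \<in> cauchy2 \<phi>" "(\<lambda>n. norm2 \<phi> (L2_rep (cls x) n - x n)) \<longlonglongrightarrow> 0"
    by (auto simp: null2_rel_def intro: null_sym)
qed

lemma norm2_cauchy2_convergent:
  assumes "x \<in> cauchy2 \<phi>" shows "convergent (\<lambda>n. norm2 \<phi> (x n))"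
  unfolding Cauchy_convergent_iff[symmetric]
proof (rule metric_CauchyI)
  fix e :: real assume "e > 0"
  then obtain N where "\<forall>m\<ge>N. \<forall>n\<ge>N. norm2 \<phi> (x m - x n) < e"
    using assms unfolding cauchy2_def by blast
  then show "\<exists>N. \<forall>m\<ge>N. \<forall>n\<ge>N. dist (norm2 \<phi> (x m)) (norm2 \<phi> (x n)) < e"
    unfolding dist_real_def by (meson norm2_diff_abs order_le_less_trans)
qed

text \<open>Maps that are 1-Lipschitz for the 2-norm have the same limit along equivalent sequences;
  it is applied to the 2-norm itself and to \<phi>.\<close>

lemma null_limit:
  fixes f :: "'a \<Rightarrow> 'b::real_normed_vector"
  assumes "\<And>u v. norm (f u - f v) \<le> norm2 \<phi> (u - v)"
    and "(\<lambda>n. norm2 \<phi> (y n - x n)) \<longlonglongrightarrow> 0" and "(\<lambda>n. f (y n)) \<longlonglongrightarrow> L"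
  shows "(\<lambda>n. f (x n)) \<longlonglongrightarrow> L"
proof -
  have "(\<lambda>n. f (y n) - f (x n)) \<longlonglongrightarrow> 0"
    by (rule Lim_null_comparison[OF _ assms(2)]) (simp add: assms(1))
  from tendsto_diff[OF assms(3) this] show ?thesis by simp
qed

lemma L2_norm_cls:
  assumes "x \<in> cauchy2 \<phi>"
  shows "(\<lambda>n. norm2 \<phi> (x n)) \<longlonglongrightarrow> L2_norm \<phi> (cls x)"
proof (rule null_limit[OF _ L2_rep_cls(2)[OF assms]])
  show "(\<lambda>n. norm2 \<phi> (L2_rep (cls x) n)) \<longlonglongrightarrow> L2_norm \<phi> (cls x)"
    using norm2_cauchy2_convergent[OF L2_rep_cls(1)[OF assms]]
    unfolding L2_norm_def by (simp add: convergent_LIMSEQ_iff)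
qed (simp add: norm2_diff_abs)

lemma state_diff_le: "cmod (\<phi> u - \<phi> v) \<le> norm2 \<phi> (u - v)"
  using cmod_state_le[of "u - v"] by (simp add: diff)

lemma L2_state_cls:
  assumes "x \<in> cauchy2 \<phi>"
  shows "(\<lambda>n. \<phi> (x n)) \<longlonglongrightarrow> L2_state \<phi> (cls x)"
proof (rule null_limit[OF state_diff_le L2_rep_cls(2)[OF assms]])
  have "Cauchy (\<lambda>n. \<phi> (L2_rep (cls x) n))"
  proof (rule metric_CauchyI)
    fix e :: real assume "e > 0"
    then obtain N where "\<forall>m\<ge>N. \<forall>n\<ge>N. norm2 \<phi> (L2_rep (cls x) m - L2_rep (cls x) n) < e"
      using cauchy2D[OF L2_rep_cls(1)[OF assms]] by blast
    then show "\<exists>N. \<forall>m\<ge>N. \<forall>n\<ge>N. dist (\<phi> (L2_rep (cls x) m)) (\<phi> (L2_rep (cls x) n)) < e"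
      unfolding dist_norm by (meson state_diff_le order_le_less_trans)
  qed
  then show "(\<lambda>n. \<phi> (L2_rep (cls x) n)) \<longlonglongrightarrow> L2_state \<phi> (cls x)"
    unfolding L2_state_def by (simp add: Cauchy_convergent_iff convergent_LIMSEQ_iff)
qed

lemma L2_mult_cls:
  assumes "x \<in> cauchy2 \<phi>"
  shows "L2_mult \<phi> a (cls x) b = cls (\<lambda>n. a * x n * b)"
proof -
  have "(\<lambda>n. norm2 \<phi> (a * L2_rep (cls x) n * b - a * x n * b)) \<longlonglongrightarrow> 0"
    using null_mult[OF L2_rep_cls(2)[OF assms], of a b] by (simp add: algebra_simps)
  then show ?thesis
    unfolding L2_mult_def by (subst cls_eq_iff) (auto intro: cauchy2_mult L2_rep_cls assms)
qed

lemma L2_diff_cls: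
  assumes "x \<in> cauchy2 \<phi>" "y \<in> cauchy2 \<phi>"
  shows "L2_diff \<phi> (cls x) (cls y) = cls (\<lambda>n. x n - y n)"
proof -
  have "(\<lambda>n. norm2 \<phi> (L2_rep (cls x) n - L2_rep (cls y) n - (x n - y n))) \<longlonglongrightarrow> 0"
  proof (rule Lim_null_comparison)
    show "(\<lambda>n. norm2 \<phi> (L2_rep (cls x) n - x n) + norm2 \<phi> (y n - L2_rep (cls y) n)) \<longlonglongrightarrow> 0"
      using tendsto_add[OF L2_rep_cls(2)[OF assms(1)] null_sym[OF L2_rep_cls(2)[OF assms(2)]]] by simp
    show "\<forall>\<^sub>F n in sequentially. norm (norm2 \<phi> (L2_rep (cls x) n - L2_rep (cls y) n - (x n - y n)))
        \<le> norm2 \<phi> (L2_rep (cls x) n - x n) + norm2 \<phi> (y n - L2_rep (cls y) n)"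
    proof (rule always_eventually, rule allI)
      fix n
      show "norm (norm2 \<phi> (L2_rep (cls x) n - L2_rep (cls y) n - (x n - y n)))
        \<le> norm2 \<phi> (L2_rep (cls x) n - x n) + norm2 \<phi> (y n - L2_rep (cls y) n)"
        using norm2_triangle[of "L2_rep (cls x) n - x n" "y n - L2_rep (cls y) n"]
        by (simp add: algebra_simps norm2_nonneg)
    qed
  qed
  then show ?thesis
    unfolding L2_diff_def by (subst cls_eq_iff) (auto intro: cauchy2_diff L2_rep_cls assms)
qed

lemma L2_norm_embed: "L2_norm \<phi> (L2_embed \<phi> a) = norm2 \<phi> a"
  using L2_norm_cls[OF cauchy2_const, of a] by (simp add: L2_embed_eq LIMSEQ_const_iff)

lemma L2_embed_eq_iff: "L2_embed \<phi> a = L2_embed \<phi> b \<longleftrightarrow> a = b"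
  by (simp add: L2_embed_eq cls_eq_iff cauchy2_const LIMSEQ_const_iff norm2_eq_0_iff)

lemma L2_closure_base:
  assumes "b \<in> S" shows "L2_embed \<phi> b \<in> L2_closure \<phi> S"
proof -
  have "L2_norm \<phi> (L2_diff \<phi> (L2_embed \<phi> b) (L2_embed \<phi> b)) = 0"
    using L2_norm_embed[of 0] by (simp add: L2_embed_eq L2_diff_cls cauchy2_const norm2_0)
  then show ?thesis
    using assms unfolding L2_closure_def
    by (auto simp: L2_embed_eq intro!: cls_in_L2 cauchy2_const bexI[of _ b])
qed

end

section \<open>Rectangular blocks\<close>

locale rectangular_space = tracial_state \<phi> for \<phi> :: "'a::cstar_algebra \<Rightarrow> complex" +
  fixes d :: nat and p :: "nat \<Rightarrow> 'a"
  assumes partition: "projection_partition d p"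
begin

lemma p_nonzero: "i \<in> {1..d} \<Longrightarrow> p i \<noteq> 0"
  and star_p: "i \<in> {1..d} \<Longrightarrow> star (p i) = p i"
  and p_idem: "i \<in> {1..d} \<Longrightarrow> p i * p i = p i"
  and p_orthogonal: "i \<in> {1..d} \<Longrightarrow> j \<in> {1..d} \<Longrightarrow> i \<noteq> j \<Longrightarrow> p i * p j = 0"
  using partition by (auto simp: projection_partition_def)

lemma norm_p: "i \<in> {1..d} \<Longrightarrow> norm (p i) \<le> 1"
  using cstar_identity[of "p i"] p_nonzero[of i] by (simp add: star_p p_idem power2_eq_square)

lemma state_p: "i \<in> {1..d} \<Longrightarrow> \<phi> (p i) = complex_of_real (rho \<phi> p i)"
  using Im_positive[of "p i"] by (simp add: star_p p_idem rho_def complex_eq_iff)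

lemma rho_pos: "i \<in> {1..d} \<Longrightarrow> rho \<phi> p i > 0"
  using Re_positive[of "p i"] faithful[of "p i"] p_nonzero[of i] state_p[of i]
  by (fastforce simp: star_p p_idem)

text \<open>Compressing a representative term by term shows that every term can be taken in the
  block, so identities with \<open>p i\<close> and \<open>p j\<close> hold exactly and not only in
  the limit.\<close>

lemma L2_block_iff:
  assumes "i \<in> {1..d}" "j \<in> {1..d}"
  shows "\<xi> \<in> L2_block \<phi> p i j \<longleftrightarrow> (\<exists>x\<in>cauchy2 \<phi>. (\<forall>n. p i * x n = x n \<and> x n * p j = x n) \<and> \<xi> = cls x)"
proof
  assume "\<xi> \<in> L2_block \<phi> p i j"
  then obtain \<eta> where \<eta>: "\<eta> \<in> L2 \<phi>" "\<xi> = L2_mult \<phi> (p i) \<eta> (p j)"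
    unfolding L2_block_def by blast
  then obtain y where y: "y \<in> cauchy2 \<phi>" "\<eta> = cls y" using L2_cases by blast
  show "\<exists>x\<in>cauchy2 \<phi>. (\<forall>n. p i * x n = x n \<and> x n * p j = x n) \<and> \<xi> = cls x"
  proof (intro bexI[of _ "\<lambda>n. p i * y n * p j"] conjI allI)
    show "p i * (p i * y n * p j) = p i * y n * p j" for n
      using assms by (simp add: mult.assoc[symmetric] p_idem)
    show "p i * y n * p j * p j = p i * y n * p j" for n
      using assms by (simp add: mult.assoc p_idem)
  qed (use \<eta> y in \<open>auto simp: L2_mult_cls intro: cauchy2_mult\<close>)
next
  assume "\<exists>x\<in>cauchy2 \<phi>. (\<forall>n. p i * x n = x n \<and> x n * p j = x n) \<and> \<xi> = cls x"
  then obtain x where x: "x \<in> cauchy2 \<phi>" "\<And>n. p i * x n = x n" "\<And>n. x n * p j = x n" "\<xi> = cls x"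
    by blast
  then have "\<xi> = L2_mult \<phi> (p i) (cls x) (p j)" by (simp add: L2_mult_cls)
  then show "\<xi> \<in> L2_block \<phi> p i j"
    unfolding L2_block_def using cls_in_L2[OF x(1)] by blast
qed

text \<open>Compression to one block fixes the first representative and kills the second, so the
  class is zero. This makes the descriptions in \<open>row\<close> and \<open>col\<close>
  unique.\<close>

lemma L2_block_unique:
  assumes "i \<in> {1..d}" "j \<in> {1..d}" "i' \<in> {1..d}" "j' \<in> {1..d}"
    and "\<xi> \<in> L2_block \<phi> p i j" "\<xi> \<in> L2_block \<phi> p i' j'" "\<xi> \<noteq> L2_embed \<phi> 0"
  shows "i = i' \<and> j = j'"
proof (rule ccontr)
  assume neq: "\<not> (i = i' \<and> j = j')"
  obtain x where x: "x \<in> cauchy2 \<phi>" "\<And>n. p i * x n = x n" "\<And>n. x n * p j = x n" "\<xi> = cls x"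
    using assms L2_block_iff by metis
  obtain y where y: "y \<in> cauchy2 \<phi>" "\<And>n. p i' * y n = y n" "\<And>n. y n * p j' = y n" "\<xi> = cls y"
    using assms L2_block_iff by metis
  have null: "(\<lambda>n. norm2 \<phi> (x n - y n)) \<longlonglongrightarrow> 0"
    using x y cls_eq_iff by metis
  have "p i * (x n - y n) * p j = x n" for n
  proof -
    have "p i * y n * p j = (p i * p i') * y n * (p j' * p j)"
      using y(2)[of n] y(3)[of n] by (metis mult.assoc)
    also have "\<dots> = 0" using neq assms by (auto simp: p_orthogonal)
    finally show ?thesis by (simp only: right_diff_distrib left_diff_distrib x diff_zero)
  qed
  then have "(\<lambda>n. norm2 \<phi> (x n)) \<longlonglongrightarrow> 0"
    using null_mult[OF null, of "p i" "p j"] by simp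
  then have "cls x = L2_embed \<phi> 0"
    by (simp add: L2_embed_eq cls_eq_iff x(1) cauchy2_const)
  then show False using assms(7) x by simp
qed

lemma row_col_eq:
  assumes "i \<in> {1..d}" "j \<in> {1..d}" "\<xi> \<in> L2_block \<phi> p i j" "\<xi> \<noteq> L2_embed \<phi> 0"
  shows "row \<phi> d p \<xi> = i" "col \<phi> d p \<xi> = j"
  unfolding row_def col_def using assms L2_block_unique by (intro the_equality; metis)+

lemma simple_in_L2_block:
  assumes "simple \<phi> d p \<xi>"
  shows "\<xi> \<in> L2_block \<phi> p (row \<phi> d p \<xi>) (col \<phi> d p \<xi>)"
  using assms row_col_eq unfolding simple_def by metis

lemma L2_embed_in_block:
  assumes "i \<in> {1..d}" "j \<in> {1..d}" "p i * x = x" "x * p j = x"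
  shows "L2_embed \<phi> x \<in> L2_block \<phi> p i j"
  unfolding L2_block_iff[OF assms(1,2)] L2_embed_eq using assms by (intro bexI[of _ "\<lambda>n. x"]) (auto simp: cauchy2_const)

end

section \<open>Conjugate systems of a pair of adjoint elements\<close>

primrec alternating :: "bool \<Rightarrow> nat \<Rightarrow> bool list" where
  "alternating i 0 = []"
| "alternating i (Suc n) = i # alternating (\<not> i) n"

lemma length_alternating [simp]: "length (alternating i n) = n"
  by (induction n arbitrary: i) auto

lemma nth_alternating: "m < n \<Longrightarrow> alternating i n ! m = (if even m then i else \<not> i)"
  by (induction n arbitrary: i m) (auto simp: nth_Cons split: nat.split)

lemma take_alternating: "m \<le> n \<Longrightarrow> take m (alternating i n) = alternating i m"
  by (rule nth_equalityI) (auto simp: nth_alternating)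

lemma drop_alternating: "m \<le> n \<Longrightarrow> drop m (alternating i n) = alternating (if even m then i else \<not> i) (n - m)"
  by (rule nth_equalityI) (auto simp: nth_alternating)

lemma prod_alternating_even:
  "prod_list (map f (alternating i (2 * n))) = (f i * f (\<not> i) :: 'a::monoid_mult) ^ n"
  by (induction n) (auto simp: mult.assoc)

lemma prod_alternating_odd:
  "prod_list (map f (alternating i (Suc (2 * n)))) = (f i * f (\<not> i) :: 'a::monoid_mult) ^ n * f i"
  by (induction n) (auto simp: mult.assoc)

text \<open>In an alternating word that begins with \<open>i\<close>, the letter \<open>i\<close>
  occupies exactly the even positions; only these survive in the conjugate relation.\<close>

lemma sum_even_indices:
  fixes f :: "nat \<Rightarrow> 'a::comm_monoid_add"
  assumes "\<And>m. odd m \<Longrightarrow> f m = 0"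
  shows "(\<Sum>m<Suc (2 * n). f m) = (\<Sum>j\<le>n. f (2 * j))"
  by (induction n) (auto simp: assms)

text \<open>Unlike the real \<open>span\<close>, it is closed under the complex scalars that
  \<open>generated_algebra\<close> allows.\<close>

inductive_set complex_span :: "'a::cstar_algebra set \<Rightarrow> 'a set" for S :: "'a set" where
  span_base: "x \<in> S \<Longrightarrow> x \<in> complex_span S"
| span_add: "x \<in> complex_span S \<Longrightarrow> y \<in> complex_span S \<Longrightarrow> x + y \<in> complex_span S"
| span_scale: "x \<in> complex_span S \<Longrightarrow> c *\<^sub>C x \<in> complex_span S"

text \<open>The elements whose right multiplication preserves the span form an algebra, so it
  suffices to test generators. No normal form for the elements of the algebra is required.\<close>

lemma complex_span_mult_generated:
  assumes S: "\<And>z s. z \<in> S \<Longrightarrow> s \<in> T \<Longrightarrow> z * s \<in> complex_span S"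
    and b: "b \<in> generated_algebra T" and z: "z \<in> complex_span S"
  shows "z * b \<in> complex_span S"
  using b z
proof (induction b arbitrary: z)
  case (gen_base s)
  from gen_base(2) show ?case
    by induction (auto intro: S gen_base(1) span_add span_scale simp: distrib_right scaleC_mult_left)
next
  case (gen_mult x y)
  then show ?case by (simp flip: mult.assoc)
qed (auto intro: span_add span_scale simp: distrib_left scaleC_mult_right)

section \<open>The two letters and their square sequences\<close>

locale adjoint_pair = rectangular_space \<phi> d p
  for \<phi> :: "'a::cstar_algebra \<Rightarrow> complex" and d :: nat and p :: "nat \<Rightarrow> 'a" +
  fixes k l :: nat and a :: 'a
  assumes kl: "k \<in> {1..d}" "l \<in> {1..d}" "k \<noteq> l"
    and a_block: "a \<in> block p k l" and a_nonzero: "a \<noteq> 0"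
begin

text \<open>Indexing by \<open>bool\<close> makes negation the adjoint: \<open>gen i\<close> leads
  from \<open>src i\<close> to \<open>src (\<not> i)\<close>, and each argument covers both letters
  at once.\<close>

definition gen :: "bool \<Rightarrow> 'a" where "gen i = (if i then a else star a)"
definition src :: "bool \<Rightarrow> nat" where "src i = (if i then k else l)"

lemma src_range: "src i \<in> {1..d}"
  and src_inj: "src i = src j \<longleftrightarrow> i = j"
  using kl by (auto simp: src_def)

lemma star_gen: "star (gen i) = gen (\<not> i)"
  by (auto simp: gen_def star_star)

lemma gen_nonzero: "gen i \<noteq> 0"
  using a_nonzero star_zero star_star[of a] by (auto simp: gen_def)

lemma p_gen: "p (src i) * gen i = gen i" and gen_p: "gen i * p (src (\<not> i)) = gen i"
proof -
  obtain x where x: "a = p k * x * p l" using a_block by (auto simp: block_def)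
  have a: "p k * a = a" "a * p l = a"
    using p_idem[OF kl(1)] p_idem[OF kl(2)] unfolding x by (metis mult.assoc)+
  have "p l * star a = star a" "star a * p k = star a"
    using arg_cong[OF a(2), of star] arg_cong[OF a(1), of star] kl by (simp_all add: star_mult star_p)
  then show "p (src i) * gen i = gen i" "gen i * p (src (\<not> i)) = gen i"
    using a by (auto simp: gen_def src_def)
qed

lemma gen_p_other: "gen i * p (src i) = 0"
proof -
  have "gen i * p (src i) = gen i * (p (src (\<not> i)) * p (src i))"
    by (metis gen_p mult.assoc)
  then show ?thesis by (simp add: p_orthogonal[OF src_range src_range] src_inj)
qed

lemma gen_square: "gen i * gen i = 0"
  by (metis gen_p_other p_gen mult.assoc mult_zero_left)

lemma norm2_gen: "norm2 \<phi> (gen i) = norm2 \<phi> a"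
  by (simp add: gen_def norm2_star)

lemma embed_block: "L2_embed \<phi> (gen i) \<in> L2_block \<phi> p (src i) (src (\<not> i))"
  by (intro L2_embed_in_block src_range p_gen gen_p)

lemma embed_nonzero: "L2_embed \<phi> (gen i) \<noteq> L2_embed \<phi> 0"
  by (simp add: L2_embed_eq_iff gen_nonzero)

lemma row_embed: "row \<phi> d p (L2_embed \<phi> (gen i)) = src i"
  and col_embed: "col \<phi> d p (L2_embed \<phi> (gen i)) = src (\<not> i)"
  using row_col_eq[OF src_range src_range embed_block embed_nonzero] by auto

lemma simple_embed: "simple \<phi> d p (L2_embed \<phi> (gen i))"
  unfolding simple_def using embed_block embed_nonzero src_range by blast

lemma self_adjoint_gen: "self_adjoint_family \<phi> d p UNIV gen"
  unfolding self_adjoint_family_def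
  by (auto simp: simple_embed star_gen intro!: exI[of _ Not])

text \<open>The column of \<xi> forces the first letter, each letter forces the next to be its
  adjoint, and closing the cycle forces the last letter to be \<open>i\<close>, so the length is
  odd. The empty word does not close up because \<open>src i\<close> and
  \<open>src (\<not> i)\<close> differ.\<close>

lemma square_sequence_iff:
  assumes "simple \<phi> d p \<xi>" "row \<phi> d p \<xi> = src (\<not> i)" "col \<phi> d p \<xi> = src i"
  shows "square_sequence \<phi> d p (\<xi> # map (\<lambda>j. L2_embed \<phi> (gen j)) w)
    \<longleftrightarrow> (\<exists>n. w = alternating i (Suc (2 * n)))"
proof -
  let ?xs = "\<xi> # map (\<lambda>j. L2_embed \<phi> (gen j)) w"
  have nth: "?xs ! Suc m = L2_embed \<phi> (gen (w ! m))" if "m < length w" for m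
    using that by simp
  have "square_sequence \<phi> d p ?xs \<longleftrightarrow>
      (\<forall>m<Suc (length w). col \<phi> d p (?xs ! m) = row \<phi> d p (?xs ! (Suc m mod Suc (length w))))"
    using assms(1) by (auto simp: square_sequence_def simple_embed)
  also have "\<dots> \<longleftrightarrow> (\<forall>m<length w. col \<phi> d p (?xs ! m) = row \<phi> d p (?xs ! Suc m)) \<and>
      col \<phi> d p (?xs ! length w) = row \<phi> d p \<xi>"
    unfolding All_less_Suc by auto
  also have "\<dots> \<longleftrightarrow> (\<exists>n. w = alternating i (Suc (2 * n)))"
  proof
    assume asm: "(\<forall>m<length w. col \<phi> d p (?xs ! m) = row \<phi> d p (?xs ! Suc m)) \<and>
      col \<phi> d p (?xs ! length w) = row \<phi> d p \<xi>"
    have w: "w ! m = (if even m then i else \<not> i)" if "m < length w" for m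
      using that
    proof (induction m)
      case 0
      then show ?case using asm[THEN conjunct1, rule_format, of 0] assms(3)
        by (simp add: row_embed src_inj)
    next
      case (Suc m)
      then have "src (\<not> w ! m) = src (w ! Suc m)"
        using asm[THEN conjunct1, rule_format, of "Suc m"] by (simp add: row_embed col_embed)
      then show ?case using Suc by (auto simp: src_inj)
    qed
    have nonempty: "length w \<noteq> 0"
      using asm assms src_inj by auto
    then obtain N where N: "length w = Suc N" using not0_implies_Suc by blast
    then have "src (\<not> w ! N) = src (\<not> i)"
      using asm assms(2) by (simp add: col_embed)
    then have "even N" using w[of N] N by (auto simp: src_inj split: if_splits)
    then obtain n where "N = 2 * n" by blast
    then have "w = alternating i (Suc (2 * n))"
      using N w by (intro nth_equalityI) (simp_all add: nth_alternating del: alternating.simps)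
    then show "\<exists>n. w = alternating i (Suc (2 * n))" ..
  next
    assume "\<exists>n. w = alternating i (Suc (2 * n))"
    then obtain n where w: "w = alternating i (Suc (2 * n))" ..
    have len: "length w = Suc (2 * n)" unfolding w by (rule length_alternating)
    have wn: "w ! m = (if even m then i else \<not> i)" if "m < length w" for m
      using that unfolding len unfolding w by (rule nth_alternating)
    have "col \<phi> d p (?xs ! m) = row \<phi> d p (?xs ! Suc m)" if "m < length w" for m
    proof (cases m)
      case 0
      then show ?thesis using that assms(3) wn[of 0] by (simp add: row_embed)
    next
      case (Suc m')
      then show ?thesis using that wn[of m] wn[of m'] by (simp add: row_embed col_embed)
    qed
    moreover have "col \<phi> d p (?xs ! length w) = row \<phi> d p \<xi>"
      using wn[of "2 * n"] assms(2) by (simp add: len col_embed)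
    ultimately show "(\<forall>m<length w. col \<phi> d p (?xs ! m) = row \<phi> d p (?xs ! Suc m)) \<and>
      col \<phi> d p (?xs ! length w) = row \<phi> d p \<xi>" by blast
  qed
  finally show ?thesis .
qed

section \<open>Conjugate relations as identities between moments\<close>

definition mom :: "bool \<Rightarrow> nat \<Rightarrow> complex" where
  "mom i n = corner_moment \<phi> p (src i) (gen i * gen (\<not> i)) n"

lemma mom_0: "mom i 0 = 1"
  using rho_pos[OF src_range[of i]]
  by (simp add: mom_def corner_moment_def corner_state_def state_p[OF src_range])

lemma mom_Suc: "mom i (Suc n) = \<phi> ((gen i * gen (\<not> i)) ^ Suc n) / rho \<phi> p (src i)"
  by (simp add: mom_def corner_moment_def corner_state_def mult.assoc[symmetric] p_gen)

text \<open>The trace moves one letter around the cycle. At order zero no letter can be moved: both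
  moments are 1 and the weights differ.\<close>

lemma mom_swap: "rho \<phi> p (src i) * mom i (Suc n) = rho \<phi> p (src (\<not> i)) * mom (\<not> i) (Suc n)"
proof -
  have "\<phi> ((gen i * gen (\<not> i)) ^ Suc n) = \<phi> (((gen i * gen (\<not> i)) ^ n * gen i) * gen (\<not> i))"
    by (simp only: power_Suc2 mult.assoc)
  also have "\<dots> = \<phi> (gen (\<not> i) * ((gen i * gen (\<not> i)) ^ n * gen i))" by (rule trace)
  also have "\<dots> = \<phi> ((gen (\<not> i) * gen i) ^ Suc n)"
    unfolding power_mult_swap by (simp only: power_Suc mult.assoc)
  finally show ?thesis
    using rho_pos[OF src_range[of i]] rho_pos[OF src_range[of "\<not> i"]] by (simp add: mom_Suc)
qed

lemma word_state_alternating: "word_state \<phi> p (src i) (map gen (alternating i (2 * n))) = mom i n"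
proof (cases n)
  case 0
  then show ?thesis by (simp add: word_state_def mom_0)
next
  case (Suc m)
  then have "alternating i (2 * n) \<noteq> []" by simp
  then show ?thesis
    unfolding word_state_def map_is_Nil_conv prod_alternating_even
    using Suc by (simp add: mom_Suc corner_state_def)
qed

text \<open>Removing the letter at position 2j from the alternating word of length 2n + 1 leaves
  alternating words of lengths 2j and 2(n - j) that start at opposite corners, hence a convolution
  of the two moment sequences.\<close>

lemma conjugate_relations_iff:
  "conjugate_relations \<phi> d p UNIV gen \<xi> \<longleftrightarrow>
    (\<forall>i. simple \<phi> d p (\<xi> i) \<and> row \<phi> d p (\<xi> i) = src (\<not> i) \<and> col \<phi> d p (\<xi> i) = src i \<and>
      (\<forall>n. L2_corner_state \<phi> p (src (\<not> i)) (L2_mult \<phi> 1 (\<xi> i) ((gen i * gen (\<not> i)) ^ n * gen i)) =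
        (\<Sum>j\<le>n. mom i j * mom (\<not> i) (n - j))))"
proof -
  have sum: "(\<Sum>m<length (alternating i (Suc (2 * n))). of_bool (i = alternating i (Suc (2 * n)) ! m) *
        word_state \<phi> p (src i) (map gen (take m (alternating i (Suc (2 * n))))) *
        word_state \<phi> p (src (\<not> i)) (map gen (drop (Suc m) (alternating i (Suc (2 * n)))))) =
      (\<Sum>j\<le>n. mom i j * mom (\<not> i) (n - j))" (is "(\<Sum>m<_. ?f m) = _") for i n
  proof -
    have "(\<Sum>m<length (alternating i (Suc (2 * n))). ?f m) =
        (\<Sum>m<Suc (2 * n). if odd m then 0 else ?f m)"
      unfolding length_alternating
      by (intro sum.cong refl) (simp add: nth_alternating del: alternating.simps)
    also have "\<dots> = (\<Sum>j\<le>n. ?f (2 * j))" by (subst sum_even_indices) auto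
    also have "\<dots> = (\<Sum>j\<le>n. mom i j * mom (\<not> i) (n - j))"
    proof (intro sum.cong refl)
      fix j assume "j \<in> {..n}"
      then have j: "j \<le> n" by simp
      have "take (2 * j) (alternating i (Suc (2 * n))) = alternating i (2 * j)"
        using j by (intro take_alternating) simp
      moreover have "drop (Suc (2 * j)) (alternating i (Suc (2 * n))) = alternating (\<not> i) (2 * (n - j))"
        using j by (subst drop_alternating) (simp_all add: diff_mult_distrib2)
      moreover have "alternating i (Suc (2 * n)) ! (2 * j) = i"
        using j by (subst nth_alternating) simp_all
      ultimately show "?f (2 * j) = mom i j * mom (\<not> i) (n - j)"
        by (simp only: word_state_alternating of_bool_eq simp_thms mult_1)
    qed
    finally show ?thesis .
  qed
  show ?thesis
    unfolding conjugate_relations_def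
  proof (intro iffI conjI allI ballI impI)
    fix i n
    assume asm: "self_adjoint_family \<phi> d p UNIV gen \<and>
       (\<forall>i\<in>UNIV. simple \<phi> d p (\<xi> i) \<and>
        row \<phi> d p (\<xi> i) = col \<phi> d p (L2_embed \<phi> (gen i)) \<and> col \<phi> d p (\<xi> i) = row \<phi> d p (L2_embed \<phi> (gen i)) \<and>
        (\<forall>w. set w \<subseteq> UNIV \<longrightarrow> square_sequence \<phi> d p (\<xi> i # map (\<lambda>j. L2_embed \<phi> (gen j)) w) \<longrightarrow>
           L2_corner_state \<phi> p (row \<phi> d p (\<xi> i)) (L2_mult \<phi> 1 (\<xi> i) (prod_list (map gen w))) =
           (\<Sum>m<length w. of_bool (i = w ! m) *
              word_state \<phi> p (col \<phi> d p (\<xi> i)) (map gen (take m w)) *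
              word_state \<phi> p (row \<phi> d p (\<xi> i)) (map gen (drop (Suc m) w)))))"
    then show basic: "simple \<phi> d p (\<xi> i)" "row \<phi> d p (\<xi> i) = src (\<not> i)" "col \<phi> d p (\<xi> i) = src i"
      by (simp_all add: row_embed col_embed)
    have "square_sequence \<phi> d p (\<xi> i # map (\<lambda>j. L2_embed \<phi> (gen j)) (alternating i (Suc (2 * n))))"
      using square_sequence_iff[OF basic] by blast
    then have "L2_corner_state \<phi> p (row \<phi> d p (\<xi> i))
        (L2_mult \<phi> 1 (\<xi> i) (prod_list (map gen (alternating i (Suc (2 * n)))))) =
      (\<Sum>m<length (alternating i (Suc (2 * n))). of_bool (i = alternating i (Suc (2 * n)) ! m) *
              word_state \<phi> p (col \<phi> d p (\<xi> i)) (map gen (take m (alternating i (Suc (2 * n))))) *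
              word_state \<phi> p (row \<phi> d p (\<xi> i)) (map gen (drop (Suc m) (alternating i (Suc (2 * n))))))"
      using asm by blast
    then show "L2_corner_state \<phi> p (src (\<not> i)) (L2_mult \<phi> 1 (\<xi> i) ((gen i * gen (\<not> i)) ^ n * gen i)) =
        (\<Sum>j\<le>n. mom i j * mom (\<not> i) (n - j))"
      unfolding basic sum prod_alternating_odd .
  next
    fix i w
    assume asm: "\<forall>i. simple \<phi> d p (\<xi> i) \<and> row \<phi> d p (\<xi> i) = src (\<not> i) \<and> col \<phi> d p (\<xi> i) = src i \<and>
      (\<forall>n. L2_corner_state \<phi> p (src (\<not> i)) (L2_mult \<phi> 1 (\<xi> i) ((gen i * gen (\<not> i)) ^ n * gen i)) =
        (\<Sum>j\<le>n. mom i j * mom (\<not> i) (n - j)))"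
    then have basic: "simple \<phi> d p (\<xi> i)" "row \<phi> d p (\<xi> i) = src (\<not> i)" "col \<phi> d p (\<xi> i) = src i"
      by blast+
    show "simple \<phi> d p (\<xi> i)" by (rule basic)
    show "row \<phi> d p (\<xi> i) = col \<phi> d p (L2_embed \<phi> (gen i))" "col \<phi> d p (\<xi> i) = row \<phi> d p (L2_embed \<phi> (gen i))"
      by (simp_all add: basic row_embed col_embed)
    assume "square_sequence \<phi> d p (\<xi> i # map (\<lambda>j. L2_embed \<phi> (gen j)) w)"
    then obtain n where w: "w = alternating i (Suc (2 * n))"
      using square_sequence_iff[OF basic] by blast
    show "L2_corner_state \<phi> p (row \<phi> d p (\<xi> i)) (L2_mult \<phi> 1 (\<xi> i) (prod_list (map gen w))) =
           (\<Sum>m<length w. of_bool (i = w ! m) *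
              word_state \<phi> p (col \<phi> d p (\<xi> i)) (map gen (take m w)) *
              word_state \<phi> p (row \<phi> d p (\<xi> i)) (map gen (drop (Suc m) w)))"
      unfolding w basic sum prod_alternating_odd using asm by blast
  qed (rule self_adjoint_gen)
qed

section \<open>Pairing conjugate variables with words\<close>

abbreviation word :: "bool \<Rightarrow> nat \<Rightarrow> 'a" where
  "word i n \<equiv> (gen i * gen (\<not> i)) ^ n * gen i"

definition conv :: "bool \<Rightarrow> nat \<Rightarrow> complex" where
  "conv i n = (\<Sum>j\<le>n. mom i j * mom (\<not> i) (n - j))"

abbreviation alg :: "'a set" where
  "alg \<equiv> generated_algebra (range gen \<union> diag_span d p)"

text \<open>The relations for both letters thus have the same right-hand sides, so that with
  \<open>mom_swap\<close> one letter determines the other.\<close>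

lemma conv_swap: "conv (\<not> i) n = conv i n"
  unfolding conv_def
  by (rule sum.reindex_bij_witness[where i = "\<lambda>j. n - j" and j = "\<lambda>j. n - j"]) (auto simp: mult.commute)

lemma state_gen_word: "\<phi> (gen (\<not> i) * word i n) = rho \<phi> p (src (\<not> i)) * mom (\<not> i) (Suc n)"
proof -
  have "gen (\<not> i) * word i n = (gen (\<not> i) * gen i) ^ Suc n"
    unfolding power_mult_swap by (simp add: mult.assoc)
  then show ?thesis using rho_pos[OF src_range[of "\<not> i"]] by (simp add: mom_Suc)
qed

lemma L2_corner_state_mult:
  assumes "x \<in> cauchy2 \<phi>"
  shows "(\<lambda>m. \<phi> (x m * b)) \<longlonglongrightarrow> rho \<phi> p (src i) * L2_corner_state \<phi> p (src i) (L2_mult \<phi> 1 (cls x) b)"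
proof -
  have "(\<lambda>m. \<phi> (1 * x m * b)) \<longlonglongrightarrow> L2_state \<phi> (L2_mult \<phi> 1 (cls x) b)"
    unfolding L2_mult_cls[OF assms] by (rule L2_state_cls[OF cauchy2_mult[OF assms]])
  then show ?thesis
    using rho_pos[OF src_range[of i]] by (simp add: L2_corner_state_def)
qed

text \<open>Replaces statements about classes by limits of \<phi> along one sequence whose terms all
  lie in the right block.\<close>

lemma conjugate_system_representative:
  assumes "conjugate_system \<phi> d p UNIV gen \<xi>"
  obtains x where "x \<in> cauchy2 \<phi>" "\<xi> i = cls x"
    "\<And>m. p (src (\<not> i)) * x m = x m" "\<And>m. x m * p (src i) = x m"
    "\<And>n. (\<lambda>m. \<phi> (x m * word i n)) \<longlonglongrightarrow> rho \<phi> p (src (\<not> i)) * conv i n"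
    "cls x \<in> L2_closure \<phi> alg"
proof -
  have sys: "simple \<phi> d p (\<xi> i)" "row \<phi> d p (\<xi> i) = src (\<not> i)" "col \<phi> d p (\<xi> i) = src i"
    "\<And>n. L2_corner_state \<phi> p (src (\<not> i)) (L2_mult \<phi> 1 (\<xi> i) (word i n)) = conv i n"
    "\<xi> i \<in> L2_closure \<phi> alg"
    using assms unfolding conjugate_system_def conjugate_relations_iff conv_def by auto
  have "\<xi> i \<in> L2_block \<phi> p (src (\<not> i)) (src i)"
    using simple_in_L2_block[OF sys(1)] by (simp add: sys)
  then obtain x where x: "x \<in> cauchy2 \<phi>" "\<And>m. p (src (\<not> i)) * x m = x m"
      "\<And>m. x m * p (src i) = x m" "\<xi> i = cls x"
    unfolding L2_block_iff[OF src_range src_range] by blast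
  have "(\<lambda>m. \<phi> (x m * word i n)) \<longlonglongrightarrow> rho \<phi> p (src (\<not> i)) * conv i n" for n
    using L2_corner_state_mult[OF x(1), of "word i n" "\<not> i"] sys(4)[of n] by (simp add: x(4))
  then show ?thesis using that x sys(5) by metis
qed

lemma conv_0: "conv i 0 = 1"
  by (simp add: conv_def mom_0)

text \<open>Since \<open>gen i\<close> is the adjoint of \<open>gen (\<not> i)\<close>, the
  hypothesis \<open>rel\<close> gives the inner product of the class with
  \<open>gen (\<not> i)\<close>, an element of the same 2-norm as \<open>a\<close>. Equality in
  Cauchy-Schwarz makes the class its own projection onto that element.\<close>

lemma
  assumes x: "x \<in> cauchy2 \<phi>"
    and rel: "(\<lambda>m. \<phi> (x m * gen i)) \<longlonglongrightarrow> complex_of_real r"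
  shows conjugate_norm_ge: "r \<le> L2_norm \<phi> (cls x) * norm2 \<phi> a"
    and conjugate_norm_eq: "r = L2_norm \<phi> (cls x) * norm2 \<phi> a \<Longrightarrow>
      (\<lambda>m. norm2 \<phi> (x m - (r / (norm2 \<phi> a)\<^sup>2) *\<^sub>R gen (\<not> i))) \<longlonglongrightarrow> 0"
proof -
  have N: "(\<lambda>m. norm2 \<phi> (x m)) \<longlonglongrightarrow> L2_norm \<phi> (cls x)" by (rule L2_norm_cls[OF x])
  have ip: "ip (x m) (gen (\<not> i)) = Re (\<phi> (x m * gen i))" for m
    by (simp add: ip_def star_gen)
  have lim: "(\<lambda>m. ip (x m) (gen (\<not> i))) \<longlonglongrightarrow> r"
    using tendsto_Re[OF rel] by (simp add: ip)
  show "r \<le> L2_norm \<phi> (cls x) * norm2 \<phi> a"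
  proof (rule LIMSEQ_le[OF lim])
    show "(\<lambda>m. norm2 \<phi> (x m) * norm2 \<phi> a) \<longlonglongrightarrow> L2_norm \<phi> (cls x) * norm2 \<phi> a"
      by (intro tendsto_intros N)
    show "\<exists>N. \<forall>m\<ge>N. ip (x m) (gen (\<not> i)) \<le> norm2 \<phi> (x m) * norm2 \<phi> a"
      using Cauchy_Schwarz[of "x _" "gen (\<not> i)"] by (auto simp: norm2_gen abs_le_iff)
  qed
  assume eq: "r = L2_norm \<phi> (cls x) * norm2 \<phi> a"
  have pos: "norm2 \<phi> a > 0"
    using norm2_nonneg[of a] norm2_eq_0_iff[of a] a_nonzero by simp
  \<comment> \<open>The coefficient of the orthogonal projection onto \<open>gen (\<not> i)\<close>;
    the squared distance is expanded and its limit is zero.\<close>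
  define t where "t = r / (norm2 \<phi> a)\<^sup>2"
  have "(\<lambda>m. (norm2 \<phi> (x m))\<^sup>2 - 2 * t * ip (x m) (gen (\<not> i)) + t\<^sup>2 * (norm2 \<phi> a)\<^sup>2) \<longlonglongrightarrow>
      (L2_norm \<phi> (cls x))\<^sup>2 - 2 * t * r + t\<^sup>2 * (norm2 \<phi> a)\<^sup>2"
    by (intro tendsto_intros N lim)
  also have "(L2_norm \<phi> (cls x))\<^sup>2 - 2 * t * r + t\<^sup>2 * (norm2 \<phi> a)\<^sup>2 = 0"
    unfolding t_def eq using pos by (simp add: power2_eq_square field_simps)
  also have "(\<lambda>m. (norm2 \<phi> (x m))\<^sup>2 - 2 * t * ip (x m) (gen (\<not> i)) + t\<^sup>2 * (norm2 \<phi> a)\<^sup>2) =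
      (\<lambda>m. (norm2 \<phi> (x m - t *\<^sub>R gen (\<not> i)))\<^sup>2)"
    unfolding norm2_gen[of "\<not> i", symmetric] norm2_squared ip_simps
    by (simp add: ip_commute[of "gen (\<not> i)" "x _"] power2_eq_square algebra_simps)
  finally have "(\<lambda>m. sqrt ((norm2 \<phi> (x m - t *\<^sub>R gen (\<not> i)))\<^sup>2)) \<longlonglongrightarrow> sqrt 0"
    by (rule tendsto_real_sqrt)
  then show "(\<lambda>m. norm2 \<phi> (x m - (r / (norm2 \<phi> a)\<^sup>2) *\<^sub>R gen (\<not> i))) \<longlonglongrightarrow> 0"
    by (simp add: norm2_nonneg t_def)
qed

lemma null_state:
  assumes "(\<lambda>m. norm2 \<phi> (x m - y)) \<longlonglongrightarrow> 0"
  shows "(\<lambda>m. \<phi> (x m * b)) \<longlonglongrightarrow> \<phi> (y * b)"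
proof (rule null_limit[OF state_diff_le, where y = "\<lambda>m. y * b"])
  have "(\<lambda>m. norm2 \<phi> (1 * (x m - y) * b)) \<longlonglongrightarrow> 0" using null_mult[OF assms] .
  then show "(\<lambda>m. norm2 \<phi> (y * b - x m * b)) \<longlonglongrightarrow> 0"
    by (subst norm2_minus_commute) (simp add: algebra_simps)
qed simp

section \<open>Uniqueness of conjugate variables\<close>

text \<open>The alternating words that start in the corner \<open>src j\<close>. The factor
  \<open>p (src j)\<close> turns the empty word into the unit of the corner, and 0 receives the
  products of letters that do not fit.\<close>

definition corner_words :: "bool \<Rightarrow> 'a set" where
  "corner_words j = {0} \<union> {(gen j * gen (\<not> j)) ^ n * p (src j) |n. True} \<union> {word j n |n. True}"

lemma p_diag: "p (src j) * (\<Sum>q\<in>{1..d}. c q *\<^sub>C p q) = c (src j) *\<^sub>C p (src j)"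
proof -
  have "p (src j) * (\<Sum>q\<in>{1..d}. c q *\<^sub>C p q) = (\<Sum>q\<in>{1..d}. c q *\<^sub>C (p (src j) * p q))"
    by (simp add: sum_distrib_left scaleC_mult_right)
  also have "\<dots> = (\<Sum>q\<in>{1..d}. if q = src j then c (src j) *\<^sub>C p (src j) else 0)"
    by (intro sum.cong refl) (auto simp: p_orthogonal[OF src_range] p_idem[OF src_range] scaleC_zero_right)
  also have "\<dots> = c (src j) *\<^sub>C p (src j)" using src_range[of j] by simp
  finally show ?thesis .
qed

text \<open>A letter either prolongs the word or annihilates it, and an element of the diagonal acts
  on the end of the word as a scalar.\<close>

lemma corner_words_mult:
  assumes z: "z \<in> corner_words j" and s: "s \<in> range gen \<union> diag_span d p"
  shows "z * s \<in> complex_span (corner_words j)"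
proof -
  have zero: "0 \<in> complex_span (corner_words j)"
    by (rule span_base) (simp add: corner_words_def)
  have even: "(gen j * gen (\<not> j)) ^ n * p (src j) \<in> complex_span (corner_words j)" for n
    by (rule span_base) (auto simp: corner_words_def)
  have odd: "word j n \<in> complex_span (corner_words j)" for n
    by (rule span_base) (auto simp: corner_words_def)
  consider "z = 0" | n where "z = (gen j * gen (\<not> j)) ^ n * p (src j)" | n where "z = word j n"
    using z by (auto simp: corner_words_def)
  then show ?thesis
  proof cases
    case 1
    then show ?thesis using zero by simp
  next
    case (2 n)
    consider i where "s = gen i" | c where "s = (\<Sum>q\<in>{1..d}. c q *\<^sub>C p q)"
      using s by (auto simp: diag_span_def)
    then show ?thesis
    proof cases
      case (1 i)
      show ?thesis
      proof (cases "i = j")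
        case True
        then have "z * s = word j n" using 1 2 by (simp add: mult.assoc p_gen)
        then show ?thesis using odd by simp
      next
        case False
        have "p (src j) * gen i = (p (src j) * p (src i)) * gen i" by (metis p_gen mult.assoc)
        then have "p (src j) * gen i = 0"
          using False by (simp add: p_orthogonal[OF src_range src_range] src_inj)
        then show ?thesis using 1 2 zero by (simp add: mult.assoc)
      qed
    next
      case (2 c)
      then have "z * s = c (src j) *\<^sub>C ((gen j * gen (\<not> j)) ^ n * p (src j))"
        using \<open>z = _\<close> by (simp only: mult.assoc p_diag scaleC_mult_right)
      then show ?thesis using even by (auto intro: span_scale)
    qed
  next
    case (3 n)
    consider i where "s = gen i" | c where "s = (\<Sum>q\<in>{1..d}. c q *\<^sub>C p q)"
      using s by (auto simp: diag_span_def)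
    then show ?thesis
    proof cases
      case (1 i)
      show ?thesis
      proof (cases "i = j")
        case True
        then have "z * s = 0" using 1 3 by (simp add: mult.assoc gen_square)
        then show ?thesis using zero by simp
      next
        case False
        then have "i = (\<not> j)" by simp
        then have "z * s = (gen j * gen (\<not> j)) ^ n * (gen j * gen (\<not> j) * p (src j))"
          using 1 3 gen_p[of "\<not> j"] by (simp add: mult.assoc)
        also have "\<dots> = (gen j * gen (\<not> j)) ^ Suc n * p (src j)"
          by (simp only: power_Suc2 mult.assoc)
        finally show ?thesis using even by metis
      qed
    next
      case (2 c)
      have "gen j * s = gen j * (p (src (\<not> j)) * s)" by (metis gen_p mult.assoc)
      also have "\<dots> = c (src (\<not> j)) *\<^sub>C gen j"
        by (simp only: 2 p_diag scaleC_mult_right gen_p)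
      finally have "z * s = c (src (\<not> j)) *\<^sub>C word j n"
        using 3 by (simp only: mult.assoc scaleC_mult_right)
      then show ?thesis using odd by (auto intro: span_scale)
    qed
  qed
qed

lemma star_word: "star (word j n) = word (\<not> j) n"
proof -
  have "star (word j n) = gen (\<not> j) * (gen j * gen (\<not> j)) ^ n"
    by (simp add: star_mult star_power star_gen)
  then show ?thesis using power_mult_swap[of "gen (\<not> j)" "gen j" n] by simp
qed

text \<open>
  This is the uniqueness of conjugate systems: \<open>cls x\<close> and \<open>c *\<^sub>R gen (\<not> i)\<close> have the same
  pairings with the words, so their difference is orthogonal to the closure of the algebra.
\<close>

lemma conjugate_norm_unique:
  assumes x: "x \<in> cauchy2 \<phi>" and px: "\<And>m. p (src (\<not> i)) * x m = x m" and xp: "\<And>m. x m * p (src i) = x m"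
    and rel: "\<And>n. (\<lambda>m. \<phi> (x m * word i n)) \<longlonglongrightarrow> \<phi> (c *\<^sub>R gen (\<not> i) * word i n)"
    and closure: "cls x \<in> L2_closure \<phi> alg"
  shows "L2_norm \<phi> (cls x) = \<bar>c\<bar> * norm2 \<phi> a"
proof -
  define j where "j = (\<not> i)"
  have i: "i = (\<not> j)" by (simp add: j_def)
  define y where "y m = x m - c *\<^sub>R gen j" for m
  have y: "y \<in> cauchy2 \<phi>" unfolding y_def by (intro cauchy2_diff x cauchy2_const)
  define L where "L = L2_norm \<phi> (cls y)"
  have L: "(\<lambda>m. norm2 \<phi> (y m)) \<longlonglongrightarrow> L" unfolding L_def by (rule L2_norm_cls[OF y])
  then have "L \<ge> 0" by (rule LIMSEQ_le_const) (auto simp: norm2_nonneg)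
  \<comment> \<open>After compression by \<open>p (src i)\<close> the even words vanish, and the
    adjoint of an odd word is an odd word of the opposite letter, to which \<open>rel\<close>
    applies.\<close>
  have orth: "(\<lambda>m. \<phi> (y m * star (z * p (src i)))) \<longlonglongrightarrow> 0" if "z \<in> complex_span (corner_words j)" for z
    using that
  proof induction
    case (span_base z)
    then consider "z = 0" | n where "z = (gen j * gen (\<not> j)) ^ n * p (src j)" | n where "z = word j n"
      by (auto simp: corner_words_def)
    then show ?case
    proof cases
      case (2 n)
      have "p (src j) * p (src i) = 0" by (rule p_orthogonal[OF src_range src_range]) (simp add: src_inj i)
      then show ?thesis by (simp add: 2 mult.assoc star_zero zero)
    next
      case (3 n)
      have "z * p (src i) = word j n" using gen_p[of j] by (simp add: 3 mult.assoc i)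
      then have "star (z * p (src i)) = word i n" by (simp only: star_word i)
      then have "(\<lambda>m. \<phi> (y m * star (z * p (src i)))) = (\<lambda>m. \<phi> (x m * word i n) - \<phi> (c *\<^sub>R gen j * word i n))"
        by (simp only: y_def left_diff_distrib diff)
      then show ?thesis using tendsto_diff[OF rel[of n] tendsto_const[of "\<phi> (c *\<^sub>R gen j * word i n)"]]
        by (simp add: j_def)
    qed (simp add: star_zero zero)
  next
    case (span_add u v)
    then show ?case using tendsto_add[OF span_add.IH] by (simp add: distrib_right distrib_left star_add add)
  next
    case (span_scale u b)
    then show ?case using tendsto_mult_right_zero[OF span_scale.IH, of "cnj b"]
      by (simp add: scaleC_mult_left scaleC_mult_right star_scaleC scaleC)
  qed
  have "L \<le> e" if "e > 0" for e
  proof -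
    obtain b where b: "b \<in> alg" "L2_norm \<phi> (L2_diff \<phi> (cls x) (L2_embed \<phi> b)) < e"
      using closure \<open>e > 0\<close> unfolding L2_closure_def by blast
    define N where "N = L2_norm \<phi> (L2_diff \<phi> (cls x) (L2_embed \<phi> b))"
    have N: "(\<lambda>m. norm2 \<phi> (x m - b)) \<longlonglongrightarrow> N"
      unfolding N_def L2_embed_eq L2_diff_cls[OF x cauchy2_const]
      by (intro L2_norm_cls cauchy2_diff x cauchy2_const)
    \<comment> \<open>Compressing \<open>b\<close> to the block and subtracting the multiple of
      \<open>gen j\<close> gives an approximant \<open>u\<close> of \<open>y\<close> in the
      compressed span of words, no worse than \<open>b\<close> was for \<open>x\<close>.\<close>
    define z where "z = p (src j) * b + complex_of_real (- c) *\<^sub>C gen j"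
    have "p (src j) * b \<in> complex_span (corner_words j)"
    proof (rule complex_span_mult_generated[OF corner_words_mult b(1)])
      have "p (src j) \<in> corner_words j" by (auto simp: corner_words_def intro: exI[of _ 0])
      then show "p (src j) \<in> complex_span (corner_words j)" by (rule span_base)
    qed
    moreover have "gen j \<in> corner_words j" by (auto simp: corner_words_def intro: exI[of _ 0])
    ultimately have z: "z \<in> complex_span (corner_words j)"
      unfolding z_def by (intro span_add span_scale) (auto intro: span_base)
    define u where "u = z * p (src i)"
    have "gen j * p (src i) = gen j" using gen_p[of j] by (simp add: i)
    then have u: "u = p (src j) * b * p (src i) - c *\<^sub>R gen j"
      by (simp add: u_def z_def scaleC_of_real[of "-c"] left_diff_distrib flip: of_real_minus)
    have le: "norm2 \<phi> (y m - u) \<le> norm2 \<phi> (x m - b)" for m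
    proof -
      have "y m - u = p (src j) * (x m - b) * p (src i)"
        using px[of m] xp[of m] by (simp add: y_def u j_def algebra_simps)
      then have "norm2 \<phi> (y m - u) \<le> norm (p (src j)) * norm (p (src i)) * norm2 \<phi> (x m - b)"
        using norm2_mult_both[of "p (src j)" "x m - b" "p (src i)"] by (simp add: star_p[OF src_range])
      also have "\<dots> \<le> 1 * norm2 \<phi> (x m - b)"
        by (intro mult_right_mono mult_le_one norm_p src_range norm_ge_zero norm2_nonneg)
      finally show ?thesis by simp
    qed
    \<comment> \<open>The squared norm of \<open>y m\<close> is its pairing with
      \<open>y m - u\<close> plus its pairing with \<open>u\<close>. The latter tends to 0 by
      \<open>orth\<close>; \<open>Re 0\<close> records that limit.\<close>
    have "L * L \<le> L * N + Re 0"
    proof (rule LIMSEQ_le)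
      show "(\<lambda>m. norm2 \<phi> (y m) * norm2 \<phi> (y m)) \<longlonglongrightarrow> L * L" by (intro tendsto_intros L)
      show "(\<lambda>m. norm2 \<phi> (y m) * norm2 \<phi> (x m - b) + Re (\<phi> (y m * star u))) \<longlonglongrightarrow> L * N + Re 0"
        using orth[OF z] unfolding u_def by (intro tendsto_intros L N)
      have "norm2 \<phi> (y m) * norm2 \<phi> (y m) \<le> norm2 \<phi> (y m) * norm2 \<phi> (x m - b) + Re (\<phi> (y m * star u))" for m
      proof -
        have "norm2 \<phi> (y m) * norm2 \<phi> (y m) = ip (y m) (y m - u) + ip (y m) u"
          using norm2_squared[of "y m"] by (simp add: ip_simps power2_eq_square)
        also have "ip (y m) (y m - u) \<le> norm2 \<phi> (y m) * norm2 \<phi> (y m - u)"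
          using Cauchy_Schwarz[of "y m" "y m - u"] by simp
        also have "\<dots> \<le> norm2 \<phi> (y m) * norm2 \<phi> (x m - b)"
          by (intro mult_left_mono le norm2_nonneg)
        finally show ?thesis by (simp add: ip_def)
      qed
      then show "\<exists>M. \<forall>m\<ge>M. norm2 \<phi> (y m) * norm2 \<phi> (y m)
          \<le> norm2 \<phi> (y m) * norm2 \<phi> (x m - b) + Re (\<phi> (y m * star u))" by blast
    qed
    then have "L * L \<le> L * N" by simp
    then have "L \<le> N \<or> L = 0" using \<open>L \<ge> 0\<close> by (auto simp: mult_le_cancel_left)
    then show "L \<le> e" using b(2) \<open>e > 0\<close> by (auto simp: N_def)
  qed
  then have "L = 0" using \<open>L \<ge> 0\<close> by (meson field_le_epsilon dense_ge order_antisym)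
  then have "(\<lambda>m. norm2 \<phi> (c *\<^sub>R gen j - x m)) \<longlonglongrightarrow> 0"
    using L by (subst norm2_minus_commute) (simp add: y_def)
  then have "(\<lambda>m. norm2 \<phi> (x m)) \<longlonglongrightarrow> norm2 \<phi> (c *\<^sub>R gen j)"
    by (rule null_limit[rotated]) (simp_all add: norm2_diff_abs)
  then show ?thesis
    using LIMSEQ_unique[OF L2_norm_cls[OF x]] by (simp add: norm2_scaleR norm2_gen)
qed

section \<open>From the relations to the Marchenko-Pastur recursion\<close>

abbreviation "rk \<equiv> rho \<phi> p k"
abbreviation "rl \<equiv> rho \<phi> p l"

lemma rk_pos: "rk > 0" and rl_pos: "rl > 0"
  using rho_pos kl by auto

lemma norm2_pos: "norm2 \<phi> a > 0"
  using norm2_nonneg[of a] norm2_eq_0_iff[of a] a_nonzero by simp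

lemma mom_False_Suc: "rl * mom False (Suc n) = rk * mom True (Suc n)"
  using mom_swap[of True n] by (simp add: src_def)

text \<open>\<open>mom_swap\<close> eliminates the moments in the corner \<open>l\<close>, and the
  mismatch of the weights at order zero affects only the end term \<open>j = n\<close>.\<close>

lemma conv_moments:
  "rl * conv True n = rk * (\<Sum>j\<le>n. mom True j * mom True (n - j)) + (rl - rk) * mom True n"
proof -
  have F: "rl * mom False q = rk * mom True q + (rl - rk) * of_bool (q = 0)" for q
    by (cases q) (auto simp: mom_0 mom_False_Suc)
  have "rl * conv True n = (\<Sum>j\<le>n. mom True j * (rl * mom False (n - j)))"
    by (simp add: conv_def sum_distrib_left mult_ac)
  also have "\<dots> = (\<Sum>j\<le>n. rk * (mom True j * mom True (n - j)) + (if j = n then (rl - rk) * mom True n else 0))"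
    unfolding F by (intro sum.cong) (auto simp: algebra_simps)
  finally show ?thesis by (simp add: sum.distrib sum_distrib_left)
qed

text \<open>After rescaling both sides express one recursion with initial value 1. Each moment is
  determined by the earlier ones, so satisfying it means being its solution.\<close>

lemma moments_iff:
  fixes c :: real
  assumes c: "c > 0" and le: "rk \<le> rl"
  shows "(\<forall>n. c ^ n * mom True n = complex_of_real (LINT x|marchenko_pastur (rl / rk). x ^ n)) \<longleftrightarrow>
    (\<forall>n. c * mom False (Suc n) = conv True n)"
proof -
  \<comment> \<open>The condition \<open>rk \<le> rl\<close> puts the parameter in the range where
    the density has total mass 1.\<close>
  have t: "rl / rk \<ge> 1" using rk_pos le by simp
  define M where "M n = complex_of_real (LINT x|marchenko_pastur (rl / rk). x ^ n)" for n
  define m where "m n = c ^ n * mom True n" for n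
  have M0: "M 0 = 1" unfolding M_def using marchenko_pastur_moment_0[OF t] by simp
  have M_Suc: "rk * M (Suc n) = rk * (\<Sum>j\<le>n. M j * M (n - j)) + (rl - rk) * M n" for n
    unfolding M_def marchenko_pastur_moment_Suc[OF t, of n]
    using rk_pos by (simp add: field_simps)
  \<comment> \<open>The exponents j and n - j add up to n, so the convolution is homogeneous under
    the rescaling by powers of \<open>c\<close>.\<close>
  have Sigma: "c ^ n * (rl * conv True n) = rk * (\<Sum>j\<le>n. m j * m (n - j)) + (rl - rk) * m n" for n
  proof -
    have "(\<Sum>j\<le>n. m j * m (n - j)) = c ^ n * (\<Sum>j\<le>n. mom True j * mom True (n - j))"
      unfolding m_def sum_distrib_left
    proof (intro sum.cong refl)
      fix j assume "j \<in> {..n}"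
      then have "complex_of_real c ^ n = c ^ j * c ^ (n - j)" by (simp flip: power_add)
      then show "c ^ j * mom True j * (c ^ (n - j) * mom True (n - j)) = c ^ n * (mom True j * mom True (n - j))"
        by simp
    qed
    then show ?thesis unfolding conv_moments m_def by (simp add: algebra_simps)
  qed
  have step: "c ^ n * (rl * (c * mom False (Suc n))) = rk * m (Suc n)" for n
    using mom_False_Suc[of n] by (simp add: m_def mult.left_commute[of "complex_of_real rl"] mult.left_commute[of "complex_of_real rk"] mult_ac)
  have "(\<forall>n. m n = M n) \<longleftrightarrow> (\<forall>n. c * mom False (Suc n) = conv True n)"
  proof (intro iffI allI)
    fix n assume "\<forall>n. m n = M n"
    then have "c ^ n * (rl * (c * mom False (Suc n))) = c ^ n * (rl * conv True n)"
      unfolding step Sigma by (simp add: M_Suc)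
    then show "c * mom False (Suc n) = conv True n" using c rl_pos by simp
  next
    fix n assume rel: "\<forall>n. c * mom False (Suc n) = conv True n"
    show "m n = M n"
    proof (induction n rule: less_induct)
      case (less n)
      show ?case
      proof (cases n)
        case 0
        then show ?thesis by (simp add: m_def mom_0 M0)
      next
        case (Suc q)
        have "rk * m (Suc q) = rk * (\<Sum>j\<le>q. m j * m (q - j)) + (rl - rk) * m q"
          using step[of q] Sigma[of q] rel by simp
        also have "(\<Sum>j\<le>q. m j * m (q - j)) = (\<Sum>j\<le>q. M j * M (q - j))"
          using less Suc by (intro sum.cong refl) simp
        also have "m q = M q" using less Suc by simp
        finally have "rk * m (Suc q) = rk * M (Suc q)" unfolding M_Suc .
        then show ?thesis using Suc rk_pos by simp
      qed
    qed
  qed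
  then show ?thesis unfolding m_def M_def by simp
qed

section \<open>The bound and its equality case for one variable\<close>

lemma conjugate_system_norm_ge:
  assumes "conjugate_system \<phi> d p UNIV gen \<xi>"
  shows "rho \<phi> p (src (\<not> i)) \<le> L2_norm \<phi> (\<xi> i) * norm2 \<phi> a"
proof -
  obtain x where x: "x \<in> cauchy2 \<phi>" "\<xi> i = cls x"
    "\<And>n. (\<lambda>m. \<phi> (x m * word i n)) \<longlonglongrightarrow> rho \<phi> p (src (\<not> i)) * conv i n"
    using conjugate_system_representative[OF assms] by metis
  show ?thesis
    unfolding x(2) using conjugate_norm_ge[OF x(1)] x(3)[of 0] by (simp add: conv_0)
qed

text \<open>Equality in the one-letter relation identifies the variable with a multiple of the
  adjoint letter; the relations for longer words then become identities between moments.\<close>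

lemma conjugate_system_norm_eq:
  assumes "conjugate_system \<phi> d p UNIV gen \<xi>"
    and "rho \<phi> p (src (\<not> i)) = L2_norm \<phi> (\<xi> i) * norm2 \<phi> a"
  shows "rho \<phi> p (src (\<not> i)) / (norm2 \<phi> a)\<^sup>2 * mom (\<not> i) (Suc n) = conv i n"
proof -
  let ?r = "rho \<phi> p (src (\<not> i))" and ?c = "rho \<phi> p (src (\<not> i)) / (norm2 \<phi> a)\<^sup>2"
  obtain x where x: "x \<in> cauchy2 \<phi>" "\<xi> i = cls x"
    "\<And>n. (\<lambda>m. \<phi> (x m * word i n)) \<longlonglongrightarrow> ?r * conv i n"
    using conjugate_system_representative[OF assms(1)] by metis
  have "(\<lambda>m. \<phi> (x m * gen i)) \<longlonglongrightarrow> complex_of_real ?r" using x(3)[of 0] by (simp add: conv_0)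
  then have "(\<lambda>m. norm2 \<phi> (x m - ?c *\<^sub>R gen (\<not> i))) \<longlonglongrightarrow> 0"
    using conjugate_norm_eq[OF x(1)] assms(2) x(2) by simp
  then have "(\<lambda>m. \<phi> (x m * word i n)) \<longlonglongrightarrow> \<phi> (?c *\<^sub>R gen (\<not> i) * word i n)"
    by (rule null_state)
  then have "?r * conv i n = \<phi> (?c *\<^sub>R gen (\<not> i) * word i n)"
    using x(3) LIMSEQ_unique by blast
  also have "\<dots> = ?c * (?r * mom (\<not> i) (Suc n))"
    by (simp only: mult_scaleR_left scaleR state_gen_word)
  finally have "?r * conv i n = ?r * (?c * mom (\<not> i) (Suc n))" by (simp only: mult.left_commute)
  moreover have "complex_of_real ?r \<noteq> 0" using rho_pos[OF src_range[of "\<not> i"]] by simp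
  ultimately have "conv i n = ?c * mom (\<not> i) (Suc n)" by (metis mult_left_cancel)
  then show ?thesis ..
qed

context
  fixes c :: real
  assumes c: "c > 0" and c_rel: "\<And>n. c * mom False (Suc n) = conv True n"
begin

text \<open>It is \<open>c\<close> for the variable of \<open>a\<close> and
  \<open>c * rk / rl\<close> for that of \<open>star a\<close>. This ratio is forced because
  \<open>conv\<close> is symmetric while \<open>mom_swap\<close> exchanges the moments with weights
  \<open>rk\<close> and \<open>rl\<close>.\<close>

definition coeff :: "bool \<Rightarrow> real" where
  "coeff i = c * rho \<phi> p (src (\<not> i)) / rl"

lemma coeff_pos: "coeff i > 0"
  using c rl_pos rho_pos[OF src_range[of "\<not> i"]] by (simp add: coeff_def)

lemma coeff_rel: "coeff i * mom (\<not> i) (Suc n) = conv i n"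
proof (cases i)
  case True
  then show ?thesis using c_rel[of n] rl_pos by (simp add: coeff_def src_def)
next
  case False
  have "coeff False * mom True (Suc n) = c / rl * (rk * mom True (Suc n))"
    by (simp add: coeff_def src_def)
  also have "\<dots> = c * mom False (Suc n)" using rl_pos by (simp flip: mom_False_Suc)
  finally show ?thesis using False conv_swap[of True n] by (simp add: c_rel)
qed

lemma state_coeff: "\<phi> (coeff i *\<^sub>R gen (\<not> i) * word i n) = rho \<phi> p (src (\<not> i)) * conv i n"
proof -
  have "\<phi> (coeff i *\<^sub>R gen (\<not> i) * word i n) = rho \<phi> p (src (\<not> i)) * (coeff i * mom (\<not> i) (Suc n))"
    by (simp only: mult_scaleR_left scaleR state_gen_word mult.left_commute)
  then show ?thesis by (simp only: coeff_rel)
qed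

lemma coeff_conjugate_system:
  "conjugate_system \<phi> d p UNIV gen (\<lambda>i. L2_embed \<phi> (coeff i *\<^sub>R gen (\<not> i)))"
  unfolding conjugate_system_def conjugate_relations_iff
proof (intro conjI allI ballI)
  fix i n
  let ?b = "coeff i *\<^sub>R gen (\<not> i)"
  have block: "L2_embed \<phi> ?b \<in> L2_block \<phi> p (src (\<not> i)) (src i)"
    using gen_p[of "\<not> i"] by (intro L2_embed_in_block src_range) (simp_all add: p_gen)
  have nonzero: "L2_embed \<phi> ?b \<noteq> L2_embed \<phi> 0"
    using coeff_pos[of i] by (simp add: L2_embed_eq_iff gen_nonzero)
  show "simple \<phi> d p (L2_embed \<phi> ?b)"
    unfolding simple_def using block nonzero src_range by blast
  show "row \<phi> d p (L2_embed \<phi> ?b) = src (\<not> i)" "col \<phi> d p (L2_embed \<phi> ?b) = src i"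
    using row_col_eq[OF src_range src_range block nonzero] by auto
  have "(\<lambda>m. \<phi> (?b * word i n)) \<longlonglongrightarrow> rho \<phi> p (src (\<not> i)) *
      L2_corner_state \<phi> p (src (\<not> i)) (L2_mult \<phi> 1 (L2_embed \<phi> ?b) (word i n))"
    unfolding L2_embed_eq by (rule L2_corner_state_mult[OF cauchy2_const])
  then show "L2_corner_state \<phi> p (src (\<not> i)) (L2_mult \<phi> 1 (L2_embed \<phi> ?b) (word i n)) =
      (\<Sum>j\<le>n. mom i j * mom (\<not> i) (n - j))"
    unfolding state_coeff LIMSEQ_const_iff
    using rho_pos[OF src_range[of "\<not> i"]] by (simp add: conv_def)
  have "complex_of_real (coeff i) *\<^sub>C gen (\<not> i) \<in> alg"
    by (intro gen_scale gen_base) simp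
  then show "L2_embed \<phi> ?b \<in> L2_closure \<phi> alg"
    by (intro L2_closure_base) (simp add: scaleC_of_real)
qed

text \<open>Holds for every conjugate system, hence for the one selected in
  \<open>fisher_information\<close>: uniqueness gives it the norm of the explicit multiple.\<close>

lemma coeff_norm:
  assumes "conjugate_system \<phi> d p UNIV gen \<xi>"
  shows "L2_norm \<phi> (\<xi> i) * norm2 \<phi> a = rho \<phi> p (src (\<not> i))"
proof -
  obtain x where x: "x \<in> cauchy2 \<phi>" "\<xi> i = cls x"
    "\<And>m. p (src (\<not> i)) * x m = x m" "\<And>m. x m * p (src i) = x m"
    "\<And>n. (\<lambda>m. \<phi> (x m * word i n)) \<longlonglongrightarrow> rho \<phi> p (src (\<not> i)) * conv i n"
    "cls x \<in> L2_closure \<phi> alg"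
    using conjugate_system_representative[OF assms] by metis
  have norm: "L2_norm \<phi> (cls x) = \<bar>coeff i\<bar> * norm2 \<phi> a"
    by (rule conjugate_norm_unique[OF x(1,3,4) _ x(6)]) (simp only: state_coeff x(5))
  \<comment> \<open>The one-letter relation ties the coefficient to the 2-norm of
    \<open>a\<close>.\<close>
  have "complex_of_real ((norm2 \<phi> a)\<^sup>2) = \<phi> (gen (\<not> i) * gen i)"
    using self_adjoint_state[of "gen (\<not> i)"] by (simp add: star_gen norm2_gen)
  also have "coeff i * \<dots> = rho \<phi> p (src (\<not> i))"
    using state_coeff[of i 0] by (simp add: scaleR conv_0)
  finally have "coeff i * (norm2 \<phi> a)\<^sup>2 = rho \<phi> p (src (\<not> i))"
    by (metis of_real_eq_iff of_real_mult)
  then show ?thesis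
    using coeff_pos[of i] by (simp add: x(2) norm power2_eq_square mult.assoc)
qed

end

section \<open>The inequality for the Fisher information\<close>

lemma fisher_information_pair_eq:
  "fisher_information_pair \<phi> d p a (star a) = fisher_information \<phi> d p UNIV gen"
proof -
  have "(\<lambda>t. if t then a else star a) = gen" by (simp add: gen_def fun_eq_iff)
  then show ?thesis by (simp add: fisher_information_pair_def)
qed

lemma Fisher_information_bound:
  assumes "rk \<le> rl"
  shows "ennreal (Re (\<phi> (a * star a))) * fisher_information_pair \<phi> d p a (star a) \<ge> ennreal (rk\<^sup>2 + rl\<^sup>2)
    \<and> (ennreal (Re (\<phi> (a * star a))) * fisher_information_pair \<phi> d p a (star a) = ennreal (rk\<^sup>2 + rl\<^sup>2)
      \<longleftrightarrow> (\<exists>c::real. c > 0 \<and> (\<forall>n. corner_moment \<phi> p k (c *\<^sub>R (a * star a)) n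
            = complex_of_real (LINT x|marchenko_pastur (rl / rk). x ^ n))))"
    (is "?F \<ge> _ \<and> (?F = _ \<longleftrightarrow> ?R)")
proof -
  let ?s = "norm2 \<phi> a"
  have A: "Re (\<phi> (a * star a)) = ?s\<^sup>2" by (simp add: self_adjoint_state)
  have moment: "corner_moment \<phi> p k (c *\<^sub>R (a * star a)) n = c ^ n * mom True n" for c :: real and n
  proof -
    have "(c *\<^sub>R (a * star a)) ^ n = c ^ n *\<^sub>R (a * star a) ^ n" by (simp add: scaleR_power)
    then show ?thesis
      by (simp add: mom_def corner_moment_def corner_state_def scaleR src_def gen_def)
  qed
  have R: "?R \<longleftrightarrow> (\<exists>c>0. \<forall>n. complex_of_real c * mom False (Suc n) = conv True n)"
    unfolding moment by (intro ex_cong1 conj_cong refl moments_iff[OF _ assms])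
  show ?thesis
  proof (cases "\<exists>\<xi>. conjugate_system \<phi> d p UNIV gen \<xi>")
    case False
    \<comment> \<open>A constant satisfying the moment condition would produce a conjugate system.
      Without one both sides of the equivalence fail, the Fisher information being infinite.\<close>
    then have "\<not> ?R" unfolding R using coeff_conjugate_system by metis
    moreover have "?F = \<infinity>"
      unfolding A fisher_information_pair_eq fisher_information_def if_not_P[OF False]
      using norm2_pos by (simp add: ennreal_mult_top)
    moreover have "\<infinity> \<ge> ennreal r" "\<infinity> \<noteq> ennreal r" for r by simp_all
    ultimately show ?thesis by (metis (no_types))
  next
    case True
    define \<xi> where "\<xi> = (SOME \<xi>. conjugate_system \<phi> d p UNIV gen \<xi>)"
    have sys: "conjugate_system \<phi> d p UNIV gen \<xi>" unfolding \<xi>_def using True by (rule someI_ex)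
    define N where "N i = L2_norm \<phi> (\<xi> i) * ?s" for i
    have F: "?F = ennreal ((N True)\<^sup>2 + (N False)\<^sup>2)"
    proof -
      have "?F = ennreal (?s\<^sup>2) * (\<Sum>i\<in>UNIV. ennreal ((L2_norm \<phi> (\<xi> i))\<^sup>2))"
        using True unfolding A fisher_information_pair_eq fisher_information_def \<xi>_def by simp
      also have "\<dots> = ennreal (?s\<^sup>2 * ((L2_norm \<phi> (\<xi> True))\<^sup>2 + (L2_norm \<phi> (\<xi> False))\<^sup>2))"
        by (simp add: UNIV_bool ennreal_mult add.commute flip: ennreal_plus)
      finally show ?thesis by (simp add: N_def power_mult_distrib algebra_simps)
    qed
    have N: "N True \<ge> rl" "N False \<ge> rk"
      using conjugate_system_norm_ge[OF sys, of True] conjugate_system_norm_ge[OF sys, of False]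
      by (simp_all add: N_def src_def)
    then have sq: "(N True)\<^sup>2 \<ge> rl\<^sup>2" "(N False)\<^sup>2 \<ge> rk\<^sup>2"
      using rk_pos rl_pos by (simp_all add: power_mono)
    have "?F = ennreal (rk\<^sup>2 + rl\<^sup>2) \<longleftrightarrow> (N True)\<^sup>2 + (N False)\<^sup>2 = rk\<^sup>2 + rl\<^sup>2"
      unfolding F by (subst ennreal_inj) auto
    also have "\<dots> \<longleftrightarrow> ?R"
    proof
      assume "(N True)\<^sup>2 + (N False)\<^sup>2 = rk\<^sup>2 + rl\<^sup>2"
      \<comment> \<open>Each square is at least its own bound, so equality of the sums forces
        equality in each. The variable of \<open>a\<close> alone then provides the constant
        \<open>rl / ?s\<^sup>2\<close>.\<close>
      then have "(N True)\<^sup>2 = rl\<^sup>2" using sq by linarith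
      then have "rl = N True" using N rl_pos by (simp add: power2_eq_iff)
      then have "rl / ?s\<^sup>2 * mom False (Suc n) = conv True n" for n
        using conjugate_system_norm_eq[OF sys, of True n] by (simp add: N_def src_def)
      then show ?R unfolding R using rl_pos norm2_pos by (intro exI[of _ "rl / ?s\<^sup>2"]) simp
    next
      assume ?R
      then obtain c :: real where c: "c > 0" "\<And>n. c * mom False (Suc n) = conv True n"
        unfolding R by blast
      have "N True = rl" "N False = rk"
        using coeff_norm[OF c sys, of True] coeff_norm[OF c sys, of False]
        by (simp_all add: N_def src_def)
      then show "(N True)\<^sup>2 + (N False)\<^sup>2 = rk\<^sup>2 + rl\<^sup>2" by simp
    qed
    finally have "?F = ennreal (rk\<^sup>2 + rl\<^sup>2) \<longleftrightarrow> ?R" .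
    moreover have "ennreal (rk\<^sup>2 + rl\<^sup>2) \<le> ?F"
      unfolding F using sq by (intro ennreal_leI) linarith
    ultimately show ?thesis by blast
  qed
qed

end

theorem theorem6p3:
  fixes \<phi> :: "'a::cstar_algebra \<Rightarrow> complex"
    and d k l :: nat
    and p :: "nat \<Rightarrow> 'a"
    and a :: 'a
  assumes "tracial_wstar_prob_space \<phi>"
    and "projection_partition d p"
    and "k \<in> {1..d}" and "l \<in> {1..d}" and "k \<noteq> l"
    and "rho \<phi> p k \<le> rho \<phi> p l"
    and "a \<in> block p k l" and "a \<noteq> 0"
  shows "ennreal (Re (\<phi> (a * star a))) * fisher_information_pair \<phi> d p a (star a)
           \<ge> ennreal ((rho \<phi> p k)\<^sup>2 + (rho \<phi> p l)\<^sup>2)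
       \<and> (ennreal (Re (\<phi> (a * star a))) * fisher_information_pair \<phi> d p a (star a)
             = ennreal ((rho \<phi> p k)\<^sup>2 + (rho \<phi> p l)\<^sup>2)
           \<longleftrightarrow> (\<exists>c::real. c > 0 \<and>
                 (\<forall>n. corner_moment \<phi> p k (c *\<^sub>R (a * star a)) n
                    = complex_of_real
                        (LINT x|marchenko_pastur (rho \<phi> p l / rho \<phi> p k). x ^ n))))"
proof -
  interpret adjoint_pair \<phi> d p k l a
    using assms tracial_stateI[OF assms(1)]
    by (simp add: adjoint_pair_def adjoint_pair_axioms_def rectangular_space_def rectangular_space_axioms_def)
  show ?thesis using assms(6) by (rule Fisher_information_bound)
qed

end
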